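(* Let $(T,\circ)$ be a unimodular network that is almost surely a tree, with $\mathbf{E}[\deg(\circ)]<\infty$ and with no leaves almost surely. Then $$\rho(T)\;\ge\; 2\exp\left\{\frac{\mathbf{E}\big[\deg(\circ)\,\log\sqrt{\deg(\circ)-1}\,\big]}{\mathbf{E}[\deg(\circ)]}\right\}\;\ge\; 2\sqrt{\mathbf{E}[\deg(\circ)]-1}.$$ Additionally, if $(T,\circ)$ has deterministically bounded degree (there is a constant $\Delta$ such that almost surely all vertex degrees of $T$ are at most $\Delta$), then $$\rho_{\mathrm{SRW}}(T)\;\ge\; 2\exp\left\{\frac{\mathbf{E}\Big[\deg(\circ)\,\log\Big(\frac{\sqrt{\deg(\circ)-1}}{\deg(\circ)}\Big)\Big]}{\mathbf{E}[\deg(\circ)]}\right\}\;\ge\;\frac{2\,\mathbf{E}[\deg(\circ)]\,\sqrt{\mathbf{E}[\deg(\circ)]-1}}{\mathbf{E}[\deg(\circ)^2]}.$$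
   Context: Graphs are simple and undirected. A rooted graph $(G,x)$ is a connected, locally finite graph $G$ with countably many vertices and a distinguished vertex $x$. $\mathcal{G}^*$ is the set of isomorphism classes of rooted graphs, with the Polish topology of local convergence: $(G_n,x_n)\to(G,x)$ iff for every $r$ the $r$-neighbourhoods $B_r(G_n,x_n)$ and $B_r(G,x)$ are isomorphic as rooted graphs for all large $n$. A random rooted graph is a $\mathcal{G}^*$-valued random variable $(G,\circ)$. It is a unimodular network if $$\mathbf{E}\Big[\sum_{x\in V(G)}f(G,\circ,x)\Big]=\mathbf{E}\Big[\sum_{x\in V(G)}f(G,x,\circ)\Big]$$ for every non-negative measurable function $f$ on the space of isomorphism classes of doubly rooted graphs $(G,x,y)$. "No leaves" means that every vertex has degree at least $2$. $W_k(G,x)$ is the set of closed walks of length $k$ in $G$ starting from $x$. The spectral radius of a unimodular network is $\rho(G)=\lim_{k\to\infty}\mathbf{E}[|W_{2k}(G,\circ)|]^{1/(2k)}\in[0,\infty]$. With $p_k(G,x)$ the $k$-step return probability to $x$ of the simple random walk on $G$ started at $x$, $\rho_{\mathrm{SRW}}(G)=\lim_{k\to\infty}\mathbf{E}[p_{2k}(G,\circ)]^{1/(2k)}$. *)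

theory Defs
  imports "HOL-Probability.Probability"
begin

section \<open>Graphs\<close>

record 'v graph =
  verts :: "'v set"
  edges :: "'v rel"

definition simple_graph :: "'v graph \<Rightarrow> bool" where
  "simple_graph G \<longleftrightarrow> edges G \<subseteq> verts G \<times> verts G \<and> sym (edges G) \<and> irrefl (edges G)"

definition nbrs :: "'v graph \<Rightarrow> 'v \<Rightarrow> 'v set" where
  "nbrs G x = edges G `` {x}"

definition deg :: "'v graph \<Rightarrow> 'v \<Rightarrow> nat" where
  "deg G x = card (nbrs G x)"

definition connected_graph :: "'v graph \<Rightarrow> bool" where
  "connected_graph G \<longleftrightarrow> (\<forall>x\<in>verts G. \<forall>y\<in>verts G. (x, y) \<in> (edges G)\<^sup>*)"

definition locally_finite :: "'v graph \<Rightarrow> bool" where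
  "locally_finite G \<longleftrightarrow> (\<forall>x\<in>verts G. finite (nbrs G x))"

definition acyclic_graph :: "'v graph \<Rightarrow> bool" where
  "acyclic_graph G \<longleftrightarrow>
     (\<nexists>c. length c \<ge> 3 \<and> distinct c \<and> successively (\<lambda>u v. (u, v) \<in> edges G) c \<and>
          (last c, hd c) \<in> edges G)"

definition closed_walks :: "nat \<Rightarrow> 'v graph \<Rightarrow> 'v \<Rightarrow> 'v list set" where
  "closed_walks k G x =
     {w. length w = Suc k \<and> hd w = x \<and> last w = x \<and> successively (\<lambda>u v. (u, v) \<in> edges G) w}"

text \<open>The walk stays put at an isolated vertex; this only concerns the one-vertex graph.\<close>

definition srw_step :: "'v graph \<Rightarrow> 'v \<Rightarrow> 'v pmf" where
  "srw_step G x = (if nbrs G x = {} then return_pmf x else pmf_of_set (nbrs G x))"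

primrec srw :: "'v graph \<Rightarrow> 'v \<Rightarrow> nat \<Rightarrow> 'v pmf" where
  "srw G x 0 = return_pmf x"
| "srw G x (Suc k) = bind_pmf (srw G x k) (srw_step G)"

definition graph_iso :: "('v \<Rightarrow> 'w) \<Rightarrow> 'v graph \<Rightarrow> 'w graph \<Rightarrow> bool" where
  "graph_iso f G H \<longleftrightarrow>
     bij_betw f (verts G) (verts H) \<and>
     (\<forall>u\<in>verts G. \<forall>v\<in>verts G. (u, v) \<in> edges G \<longleftrightarrow> (f u, f v) \<in> edges H)"

text \<open>The subgraph induced on the vertices at distance at most \<open>r\<close> from the set \<open>A\<close>.\<close>

definition near_set :: "'v graph \<Rightarrow> 'v set \<Rightarrow> nat \<Rightarrow> 'v set" where
  "near_set G A r = {y. \<exists>a\<in>A. \<exists>n\<le>r. (a, y) \<in> edges G ^^ n}"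

definition nbhd :: "'v graph \<Rightarrow> 'v set \<Rightarrow> nat \<Rightarrow> 'v graph" where
  "nbhd G A r =
     \<lparr>verts = verts G \<inter> near_set G A r,
      edges = edges G \<inter> (near_set G A r \<times> near_set G A r)\<rparr>"

fun rooted_iso :: "'v graph \<times> 'v \<Rightarrow> 'w graph \<times> 'w \<Rightarrow> bool" where
  "rooted_iso (G, x) (H, y) \<longleftrightarrow> (\<exists>f. graph_iso f G H \<and> f x = y)"

fun birooted_iso :: "'v graph \<times> 'v \<times> 'v \<Rightarrow> 'w graph \<times> 'w \<times> 'w \<Rightarrow> bool" where
  "birooted_iso (G, x, x') (H, y, y') \<longleftrightarrow> (\<exists>f. graph_iso f G H \<and> f x = y \<and> f x' = y')"

fun ball_iso :: "nat \<Rightarrow> 'v graph \<times> 'v \<Rightarrow> 'w graph \<times> 'w \<Rightarrow> bool" where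
  "ball_iso r (G, x) (H, y) \<longleftrightarrow> rooted_iso (nbhd G {x} r, x) (nbhd H {y} r, y)"

fun biball_iso :: "nat \<Rightarrow> 'v graph \<times> 'v \<times> 'v \<Rightarrow> 'w graph \<times> 'w \<times> 'w \<Rightarrow> bool" where
  "biball_iso r (G, x, x') (H, y, y') \<longleftrightarrow>
     birooted_iso (nbhd G {x, x'} r, x, x') (nbhd H {y, y'} r, y, y')"

fun valid_rooted :: "'v graph \<times> 'v \<Rightarrow> bool" where
  "valid_rooted (G, x) \<longleftrightarrow>
     simple_graph G \<and> connected_graph G \<and> locally_finite G \<and> x \<in> verts G"

fun valid_birooted :: "'v graph \<times> 'v \<times> 'v \<Rightarrow> bool" where
  "valid_birooted (G, x, y) \<longleftrightarrow> valid_rooted (G, x) \<and> y \<in> verts G"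


subsection \<open>Invariance under isomorphism\<close>

lemma graph_isoD:
  assumes "graph_iso f G H"
  shows "bij_betw f (verts G) (verts H)" "inj_on f (verts G)" "f ` verts G = verts H"
    and "\<And>u v. u \<in> verts G \<Longrightarrow> v \<in> verts G \<Longrightarrow> (f u, f v) \<in> edges H \<longleftrightarrow> (u, v) \<in> edges G"
    and "\<And>u. u \<in> verts G \<Longrightarrow> f u \<in> verts H"
  using assms by (auto simp: graph_iso_def bij_betw_def)

lemma graph_iso_refl: "graph_iso (\<lambda>x. x) G G"
  by (auto simp: graph_iso_def bij_betw_def)

lemma graph_iso_trans: "graph_iso f G H \<Longrightarrow> graph_iso g H K \<Longrightarrow> graph_iso (g \<circ> f) G K"
  unfolding graph_iso_def by (auto intro: bij_betw_trans simp: bij_betw_apply)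

lemma graph_iso_inv:
  assumes "graph_iso f G H"
  shows "graph_iso (inv_into (verts G) f) H G"
    and "\<And>x. x \<in> verts G \<Longrightarrow> inv_into (verts G) f (f x) = x"
proof -
  note f = graph_isoD[OF assms]
  show "graph_iso (inv_into (verts G) f) H G"
    unfolding graph_iso_def
  proof (intro conjI ballI)
    show "bij_betw (inv_into (verts G) f) (verts H) (verts G)"
      using f(1) by (rule bij_betw_inv_into)
    fix u v assume "u \<in> verts H" "v \<in> verts H"
    then obtain a b where "a \<in> verts G" "u = f a" "b \<in> verts G" "v = f b"
      using f(3) by blast
    then show "(u, v) \<in> edges H \<longleftrightarrow>
        (inv_into (verts G) f u, inv_into (verts G) f v) \<in> edges G"
      using f(2,4) by simp
  qed
  show "inv_into (verts G) f (f x) = x" if "x \<in> verts G" for x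
    using f(2) that by simp
qed

lemma graph_iso_nbrs:
  assumes "graph_iso f G H" "simple_graph G" "simple_graph H" "x \<in> verts G"
  shows "nbrs H (f x) = f ` nbrs G x" "nbrs G x \<subseteq> verts G"
proof -
  note f = graph_isoD[OF assms(1)]
  show sub: "nbrs G x \<subseteq> verts G"
    using assms(2) by (auto simp: nbrs_def simple_graph_def)
  show "nbrs H (f x) = f ` nbrs G x"
  proof
    show "nbrs H (f x) \<subseteq> f ` nbrs G x"
    proof
      fix v assume v: "v \<in> nbrs H (f x)"
      then have "v \<in> verts H" using assms(3) by (auto simp: nbrs_def simple_graph_def)
      then obtain b where "b \<in> verts G" "v = f b" using f(3) by blast
      then show "v \<in> f ` nbrs G x" using v f(4) assms(4) by (auto simp: nbrs_def)
    qed
    show "f ` nbrs G x \<subseteq> nbrs H (f x)"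
      using sub f(4) assms(4) by (auto simp: nbrs_def)
  qed
qed

lemma graph_iso_deg:
  assumes "graph_iso f G H" "simple_graph G" "simple_graph H" "x \<in> verts G"
  shows "deg H (f x) = deg G x"
  using graph_iso_nbrs[OF assms] graph_isoD(2)[OF assms(1)]
  by (simp add: deg_def card_image inj_on_subset)

lemma successively_edges_verts:
  assumes "simple_graph G" "successively (\<lambda>u v. (u, v) \<in> edges G) w" "length w \<ge> 2"
  shows "set w \<subseteq> verts G"
  using assms(2,3)
proof (induction w)
  case (Cons a w)
  then obtain b w' where w: "w = b # w'" by (cases w) auto
  have ab: "a \<in> verts G" "b \<in> verts G"
    using Cons.prems(1) assms(1) by (auto simp: w simple_graph_def)
  show ?case
  proof (cases w')
    case Nil
    then show ?thesis using ab w by simp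
  next
    case (Cons c w'')
    then show ?thesis using Cons.IH Cons.prems w ab by auto
  qed
qed simp

lemma graph_iso_successively:
  assumes "graph_iso f G H" "set w \<subseteq> verts G"
  shows "successively (\<lambda>u v. (u, v) \<in> edges H) (map f w) \<longleftrightarrow>
         successively (\<lambda>u v. (u, v) \<in> edges G) w"
  unfolding successively_map
  by (rule successively_cong) (use assms graph_isoD(4)[OF assms(1)] in auto)

lemma closed_walks_verts:
  assumes "simple_graph G" "x \<in> verts G" "w \<in> closed_walks k G x"
  shows "set w \<subseteq> verts G"
proof (cases k)
  case 0
  then obtain a where "w = [a]" using assms(3) by (auto simp: closed_walks_def length_Suc_conv)
  then show ?thesis using assms by (auto simp: closed_walks_def)
next
  case (Suc n)
  then show ?thesis
    using assms by (intro successively_edges_verts) (auto simp: closed_walks_def)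
qed

lemma graph_iso_closed_walks:
  assumes iso: "graph_iso f G H" and G: "simple_graph G" and H: "simple_graph H"
    and x: "x \<in> verts G"
  shows "closed_walks k H (f x) = map f ` closed_walks k G x"
proof
  note f = graph_isoD[OF iso]
  show "map f ` closed_walks k G x \<subseteq> closed_walks k H (f x)"
  proof
    fix w assume "w \<in> map f ` closed_walks k G x"
    then obtain w' where w': "w' \<in> closed_walks k G x" "w = map f w'" by blast
    moreover have "w' \<noteq> []" using w' by (auto simp: closed_walks_def)
    ultimately show "w \<in> closed_walks k H (f x)"
      using graph_iso_successively[OF iso closed_walks_verts[OF G x w'(1)]]
      by (auto simp: closed_walks_def hd_map last_map)
  qed
  show "closed_walks k H (f x) \<subseteq> map f ` closed_walks k G x"
  proof
    fix w assume w: "w \<in> closed_walks k H (f x)"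
    then have "set w \<subseteq> f ` verts G"
      using closed_walks_verts[OF H _ w] f(3,5) x by blast
    then have "w \<in> map f ` lists (verts G)"
      by (simp add: lists_image[symmetric] in_lists_conv_set subset_iff)
    then obtain w' where w': "set w' \<subseteq> verts G" "w = map f w'"
      by (auto simp: in_lists_conv_set)
    have ne: "w' \<noteq> []" using w w' by (auto simp: closed_walks_def)
    then have "f (hd w') = f x" "f (last w') = f x"
      using w w' by (auto simp: closed_walks_def hd_map last_map)
    then have "hd w' = x" "last w' = x"
      using f(2) x w'(1) ne by (meson hd_in_set last_in_set inj_onD subsetD)+
    then have "w' \<in> closed_walks k G x"
      using w w'(2) graph_iso_successively[OF iso w'(1)] by (auto simp: closed_walks_def)
    then show "w \<in> map f ` closed_walks k G x" using w'(2) by blast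
  qed
qed

lemma graph_iso_card_closed_walks:
  assumes "graph_iso f G H" "simple_graph G" "simple_graph H" "x \<in> verts G"
  shows "card (closed_walks k H (f x)) = card (closed_walks k G x)"
proof -
  have "inj_on (map f) (closed_walks k G x)"
    by (rule inj_on_subset[OF inj_on_mapI[where A = "lists (verts G)"]])
       (use assms graph_isoD(2)[OF assms(1)] closed_walks_verts[OF assms(2,4)] in
         \<open>auto simp: lists_eq_set intro: inj_on_subset\<close>)
  then show ?thesis by (simp add: graph_iso_closed_walks[OF assms] card_image)
qed

lemma graph_iso_acyclic:
  assumes iso: "graph_iso f G H" and G: "simple_graph G" and "acyclic_graph H"
  shows "acyclic_graph G"
  unfolding acyclic_graph_def
proof (rule notI, elim exE conjE)
  fix c assume c: "length c \<ge> 3" "distinct c"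
    "successively (\<lambda>u v. (u, v) \<in> edges G) c" "(last c, hd c) \<in> edges G"
  have sub: "set c \<subseteq> verts G" using successively_edges_verts[OF G c(3)] c(1) by simp
  have "c \<noteq> []" using c(1) by auto
  then have "(last (map f c), hd (map f c)) \<in> edges H"
    using sub c(4) graph_isoD(4)[OF iso, of "last c" "hd c"] by (simp add: hd_map last_map subset_iff)
  moreover have "distinct (map f c)"
    using c(2) sub graph_isoD(2)[OF iso] by (simp add: distinct_map inj_on_subset)
  ultimately show False
    using \<open>acyclic_graph H\<close> c(1) c(3) graph_iso_successively[OF iso sub]
    unfolding acyclic_graph_def by (metis length_map)
qed

lemma set_pmf_srw:
  assumes "simple_graph G" "locally_finite G" "x \<in> verts G"
  shows "set_pmf (srw G x k) \<subseteq> verts G"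
proof (induction k)
  case (Suc k)
  have "set_pmf (srw_step G y) \<subseteq> verts G" if "y \<in> verts G" for y
    using assms that by (auto simp: srw_step_def locally_finite_def simple_graph_def nbrs_def)
  with Suc show ?case by auto
qed (use assms in simp)

lemma graph_iso_srw:
  assumes iso: "graph_iso f G H" and G: "simple_graph G" "locally_finite G"
    and H: "simple_graph H" and x: "x \<in> verts G"
  shows "srw H (f x) k = map_pmf f (srw G x k)"
proof (induction k)
  case (Suc k)
  have step: "srw_step H (f y) = map_pmf f (srw_step G y)" if y: "y \<in> verts G" for y
  proof (cases "nbrs G y = {}")
    case False
    then show ?thesis
      using graph_iso_nbrs[OF iso G(1) H y] graph_isoD(2)[OF iso] G(2) y
      by (simp add: srw_step_def locally_finite_def map_pmf_of_set_inj inj_on_subset)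
  qed (use graph_iso_nbrs[OF iso G(1) H y] in \<open>simp add: srw_step_def\<close>)
  show ?case
    using set_pmf_srw[OF G x, of k]
    by (auto simp: Suc map_bind_pmf bind_map_pmf intro!: bind_pmf_cong step)
qed simp

lemma graph_iso_return_prob:
  assumes iso: "graph_iso f G H" and G: "simple_graph G" "locally_finite G"
    and H: "simple_graph H" and x: "x \<in> verts G"
  shows "pmf (srw H (f x) k) (f x) = pmf (srw G x k) x"
proof -
  note inj = graph_isoD(2)[OF iso] and sub = set_pmf_srw[OF G x, of k]
  have "f -` {f x} \<inter> set_pmf (srw G x k) = {x} \<inter> set_pmf (srw G x k)"
    using inj sub x by (auto dest: inj_onD)
  then have "measure (srw G x k) (f -` {f x}) = measure (srw G x k) {x}"
    by (metis measure_Int_set_pmf)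
  then show ?thesis
    by (simp add: graph_iso_srw[OF assms] pmf_map measure_pmf_single)
qed

lemma graph_iso_relpow:
  assumes iso: "graph_iso f G H" and G: "simple_graph G" and x: "x \<in> verts G"
    and "(x, y) \<in> edges G ^^ n"
  shows "(f x, f y) \<in> edges H ^^ n \<and> y \<in> verts G"
  using assms(4)
proof (induction n arbitrary: y)
  case (Suc n)
  then obtain z where z: "(x, z) \<in> edges G ^^ n" "(z, y) \<in> edges G" by auto
  then have "y \<in> verts G" using G by (auto simp: simple_graph_def)
  with z Suc.IH[OF z(1)] show ?case
    using graph_isoD(4)[OF iso] by auto
qed (use x in simp)

lemma graph_iso_nbhd:
  assumes iso: "graph_iso f G H" and G: "simple_graph G" and H: "simple_graph H"
    and A: "A \<subseteq> verts G"
  shows "graph_iso f (nbhd G A r) (nbhd H (f ` A) r)"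
proof -
  note f = graph_isoD[OF iso]
  have 1: "f y \<in> near_set H (f ` A) r" if "y \<in> near_set G A r" for y
    using that graph_iso_relpow[OF iso G] A unfolding near_set_def by blast
  have 2: "y \<in> near_set G A r" if y: "y \<in> verts G" "f y \<in> near_set H (f ` A) r" for y
  proof -
    obtain a n where a: "a \<in> A" "n \<le> r" "(f a, f y) \<in> edges H ^^ n"
      using y(2) unfolding near_set_def by blast
    have "a \<in> verts G" using a(1) A by blast
    then show ?thesis
      using graph_iso_relpow[OF graph_iso_inv(1)[OF iso] H _ a(3)] f(5) y(1) a(1,2)
        graph_iso_inv(2)[OF iso] unfolding near_set_def by auto
  qed
  have "f ` (verts G \<inter> near_set G A r) = verts H \<inter> near_set H (f ` A) r"
  proof
    show "f ` (verts G \<inter> near_set G A r) \<subseteq> verts H \<inter> near_set H (f ` A) r"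
      using 1 f(5) by blast
    show "verts H \<inter> near_set H (f ` A) r \<subseteq> f ` (verts G \<inter> near_set G A r)"
    proof
      fix v assume v: "v \<in> verts H \<inter> near_set H (f ` A) r"
      then obtain y where "y \<in> verts G" "v = f y" using f(3) by auto
      then show "v \<in> f ` (verts G \<inter> near_set G A r)" using 2 v by simp
    qed
  qed
  moreover have "inj_on f (verts G \<inter> near_set G A r)"
    using f(2) by (rule inj_on_subset) simp
  ultimately show ?thesis
    using f(4) 1 by (simp add: graph_iso_def nbhd_def bij_betw_def)
qed

lemma rooted_isoE:
  assumes "rooted_iso P Q"
  obtains G x H f where "P = (G, x)" "Q = (H, f x)" "graph_iso f G H"
  using assms by (cases P; cases Q) auto

lemma rooted_iso_refl: "rooted_iso P P"
  by (cases P) (auto intro: graph_iso_refl)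

lemma rooted_iso_trans: "rooted_iso P Q \<Longrightarrow> rooted_iso Q R \<Longrightarrow> rooted_iso P R"
  by (cases P; cases Q; cases R) (force intro: graph_iso_trans)

lemma rooted_iso_sym: "rooted_iso (G, x) (H, y) \<Longrightarrow> x \<in> verts G \<Longrightarrow> rooted_iso (H, y) (G, x)"
  using graph_iso_inv by fastforce

lemma birooted_iso_refl: "birooted_iso P P"
  by (cases P) (auto intro: graph_iso_refl)

lemma birooted_iso_trans: "birooted_iso P Q \<Longrightarrow> birooted_iso Q R \<Longrightarrow> birooted_iso P R"
  by (cases P; cases Q; cases R) (force intro: graph_iso_trans)

lemma birooted_iso_sym:
  "birooted_iso (G, x, x') (H, y, y') \<Longrightarrow> x \<in> verts G \<Longrightarrow> x' \<in> verts G \<Longrightarrow>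
   birooted_iso (H, y, y') (G, x, x')"
  using graph_iso_inv by fastforce

lemma root_in_nbhd: "A \<subseteq> verts G \<Longrightarrow> x \<in> A \<Longrightarrow> x \<in> verts (nbhd G A r)"
  by (force simp: nbhd_def near_set_def)

lemma ball_iso_refl: "ball_iso r P P"
  by (cases P) (simp add: rooted_iso_refl del: rooted_iso.simps)

lemma ball_iso_trans: "ball_iso r P Q \<Longrightarrow> ball_iso r Q R \<Longrightarrow> ball_iso r P R"
  by (cases P; cases Q; cases R)
     (simp del: rooted_iso.simps, rule rooted_iso_trans)

lemma ball_iso_sym:
  assumes "valid_rooted P" "ball_iso r P Q"
  shows "ball_iso r Q P"
proof -
  obtain G x H y where PQ: "P = (G, x)" "Q = (H, y)" by (cases P; cases Q) auto
  have "rooted_iso (nbhd H {y} r, y) (nbhd G {x} r, x)"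
    by (rule rooted_iso_sym) (use assms PQ root_in_nbhd[of "{x}" G x r] in auto)
  then show ?thesis by (simp add: PQ del: rooted_iso.simps)
qed

lemma rooted_iso_imp_ball_iso:
  assumes "valid_rooted P" "valid_rooted Q" "rooted_iso P Q"
  shows "ball_iso r P Q"
proof -
  obtain G x H y where PQ: "P = (G, x)" "Q = (H, y)" by (cases P; cases Q) auto
  then obtain f where "graph_iso f G H" "f x = y" using assms by auto
  with graph_iso_nbhd[of f G H "{x}" r] assms show ?thesis by (auto simp: PQ)
qed

lemma biball_iso_refl: "biball_iso r P P"
  by (cases P) (simp add: birooted_iso_refl del: birooted_iso.simps)

lemma biball_iso_trans: "biball_iso r P Q \<Longrightarrow> biball_iso r Q R \<Longrightarrow> biball_iso r P R"
  by (cases P; cases Q; cases R)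
     (simp del: birooted_iso.simps, rule birooted_iso_trans)

lemma biball_iso_sym:
  assumes "valid_birooted P" "biball_iso r P Q"
  shows "biball_iso r Q P"
proof -
  obtain G x x' H y y' where PQ: "P = (G, x, x')" "Q = (H, y, y')" by (cases P; cases Q) auto
  have "birooted_iso (nbhd H {y, y'} r, y, y') (nbhd G {x, x'} r, x, x')"
    by (rule birooted_iso_sym)
       (use assms PQ root_in_nbhd[of "{x, x'}" G _ r] in auto)
  then show ?thesis by (simp add: PQ del: birooted_iso.simps)
qed

lemma birooted_iso_imp_biball_iso:
  assumes "valid_birooted P" "valid_birooted Q" "birooted_iso P Q"
  shows "biball_iso r P Q"
proof -
  obtain G x x' H y y' where PQ: "P = (G, x, x')" "Q = (H, y, y')" by (cases P; cases Q) auto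
  then obtain f where "graph_iso f G H" "f x = y" "f x' = y'" using assms by auto
  with graph_iso_nbhd[of f G H "{x, x'}" r] assms show ?thesis by (auto simp: PQ)
qed

lemma valid_rooted_iso_sym: "valid_rooted P \<Longrightarrow> rooted_iso P Q \<Longrightarrow> rooted_iso Q P"
  by (cases P; cases Q) (auto simp del: rooted_iso.simps intro: rooted_iso_sym)

lemma valid_birooted_iso_sym:
  "valid_birooted P \<Longrightarrow> birooted_iso P Q \<Longrightarrow> birooted_iso Q P"
  by (cases P; cases Q) (auto simp del: birooted_iso.simps intro: birooted_iso_sym)

lemma valid_rooted_singleton: "valid_rooted (\<lparr>verts = {x}, edges = {}\<rparr>, x)"
  by (auto simp: simple_graph_def connected_graph_def locally_finite_def nbrs_def
      irrefl_def intro: symI)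


section \<open>Isomorphism classes of rooted and doubly rooted graphs\<close>

text \<open>Every countable graph is isomorphic to one whose vertex set is a (finite or infinite)
  subset of \<^typ>\<open>nat\<close>, so such graphs represent all isomorphism classes.\<close>

quotient_type rooted_graph = "nat graph \<times> nat" /
  partial: "\<lambda>P Q. valid_rooted P \<and> valid_rooted Q \<and> rooted_iso P Q"
proof (rule part_equivpI)
  show "\<exists>P :: nat graph \<times> nat. valid_rooted P \<and> valid_rooted P \<and> rooted_iso P P"
    using valid_rooted_singleton[of "0 :: nat"] rooted_iso_refl by metis
  show "symp (\<lambda>P Q :: nat graph \<times> nat. valid_rooted P \<and> valid_rooted Q \<and> rooted_iso P Q)"
    by (rule sympI) (blast intro: valid_rooted_iso_sym)
  show "transp (\<lambda>P Q :: nat graph \<times> nat. valid_rooted P \<and> valid_rooted Q \<and> rooted_iso P Q)"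
    by (rule transpI) (blast intro: rooted_iso_trans)
qed

quotient_type birooted_graph = "nat graph \<times> nat \<times> nat" /
  partial: "\<lambda>P Q. valid_birooted P \<and> valid_birooted Q \<and> birooted_iso P Q"
proof (rule part_equivpI)
  have "valid_birooted (\<lparr>verts = {0}, edges = {}\<rparr>, 0, 0 :: nat)"
    using valid_rooted_singleton[of "0 :: nat"] by simp
  then show "\<exists>P :: nat graph \<times> nat \<times> nat. valid_birooted P \<and> valid_birooted P \<and> birooted_iso P P"
    using birooted_iso_refl by metis
  show "symp (\<lambda>P Q :: nat graph \<times> nat \<times> nat. valid_birooted P \<and> valid_birooted Q \<and> birooted_iso P Q)"
    by (rule sympI) (blast intro: valid_birooted_iso_sym)
  show "transp (\<lambda>P Q :: nat graph \<times> nat \<times> nat. valid_birooted P \<and> valid_birooted Q \<and> birooted_iso P Q)"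
    by (rule transpI) (blast intro: birooted_iso_trans)
qed


subsection \<open>Local topology\<close>

lift_definition same_ball :: "nat \<Rightarrow> rooted_graph \<Rightarrow> rooted_graph \<Rightarrow> bool" is ball_iso
  by (meson ball_iso_sym ball_iso_trans rooted_iso_imp_ball_iso)

lift_definition same_biball :: "nat \<Rightarrow> birooted_graph \<Rightarrow> birooted_graph \<Rightarrow> bool" is biball_iso
  by (meson biball_iso_sym biball_iso_trans birooted_iso_imp_biball_iso)

lemma same_ball_refl: "same_ball r X X"
  by transfer (simp add: ball_iso_refl)

lemma same_ball_trans: "same_ball r X Y \<Longrightarrow> same_ball r Y Z \<Longrightarrow> same_ball r X Z"
  by transfer (rule ball_iso_trans)

lemma same_ball_sym: "same_ball r X Y \<Longrightarrow> same_ball r Y X"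
  by transfer (blast intro: ball_iso_sym)

lemma same_biball_refl: "same_biball r X X"
  by transfer (simp add: biball_iso_refl)

lemma same_biball_trans: "same_biball r X Y \<Longrightarrow> same_biball r Y Z \<Longrightarrow> same_biball r X Z"
  by transfer (rule biball_iso_trans)

lemma same_biball_sym: "same_biball r X Y \<Longrightarrow> same_biball r Y X"
  by transfer (blast intro: biball_iso_sym)

text \<open>The topologies are generated by the sets of graphs with a prescribed ball around the root(s).
  The lemmas \<open>tendsto_rooted_graph_iff\<close> and \<open>tendsto_birooted_graph_iff\<close> below identify
  convergence in them with local convergence.\<close>

instantiation rooted_graph :: topological_space
begin

definition open_rooted_graph :: "rooted_graph set \<Rightarrow> bool" where
  "open_rooted_graph = generate_topology {{Y. same_ball r X Y} | r X. True}"

instance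
  by standard (auto simp: open_rooted_graph_def intro: generate_topology.intros)

end

instantiation birooted_graph :: topological_space
begin

definition open_birooted_graph :: "birooted_graph set \<Rightarrow> bool" where
  "open_birooted_graph = generate_topology {{Y. same_biball r X Y} | r X. True}"

instance
  by standard (auto simp: open_birooted_graph_def intro: generate_topology.intros)

end

lemma tendsto_generate_topology:
  fixes l :: "'a :: topological_space"
  assumes "(open :: 'a set \<Rightarrow> bool) = generate_topology B"
  shows "(f \<longlongrightarrow> l) F \<longleftrightarrow> (\<forall>S\<in>B. l \<in> S \<longrightarrow> (\<forall>\<^sub>F n in F. f n \<in> S))"
proof
  assume "(f \<longlongrightarrow> l) F"
  then show "\<forall>S\<in>B. l \<in> S \<longrightarrow> (\<forall>\<^sub>F n in F. f n \<in> S)"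
    using topological_tendstoD[of f l F] by (simp add: assms generate_topology.Basis)
next
  assume R: "\<forall>S\<in>B. l \<in> S \<longrightarrow> (\<forall>\<^sub>F n in F. f n \<in> S)"
  show "(f \<longlongrightarrow> l) F"
  proof (rule topological_tendstoI)
    fix S assume "open S" "l \<in> S"
    then have "generate_topology B S" by (simp add: assms)
    then show "\<forall>\<^sub>F n in F. f n \<in> S" using \<open>l \<in> S\<close>
    proof induction
      case (Int a b)
      then show ?case by (simp add: eventually_conj_iff)
    next
      case (UN K)
      then obtain k where "k \<in> K" "\<forall>\<^sub>F n in F. f n \<in> k" by auto
      then show ?case by (auto elim: eventually_mono)
    qed (use R in auto)
  qed
qed

lemma tendsto_generated_by_equiv:
  fixes l :: "'a :: topological_space"
  assumes top: "(open :: 'a set \<Rightarrow> bool) = generate_topology {{y. R r x y} | r x. True}"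
    and refl: "\<And>r x. R r x x" and sym: "\<And>r x y. R r x y \<Longrightarrow> R r y x"
    and trans: "\<And>r x y z. R r x y \<Longrightarrow> R r y z \<Longrightarrow> R r x z"
  shows "(f \<longlongrightarrow> l) F \<longleftrightarrow> (\<forall>r. \<forall>\<^sub>F n in F. R r (f n) l)"
proof
  assume "(f \<longlongrightarrow> l) F"
  show "\<forall>r. \<forall>\<^sub>F n in F. R r (f n) l"
  proof
    fix r
    have "open {y. R r l y}"
      unfolding top by (rule generate_topology.Basis) blast
    with \<open>(f \<longlongrightarrow> l) F\<close> have "\<forall>\<^sub>F n in F. f n \<in> {y. R r l y}"
      by (rule topological_tendstoD) (simp add: refl)
    then show "\<forall>\<^sub>F n in F. R r (f n) l"
      by (rule eventually_mono) (simp add: sym)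
  qed
next
  assume R: "\<forall>r. \<forall>\<^sub>F n in F. R r (f n) l"
  show "(f \<longlongrightarrow> l) F"
    unfolding tendsto_generate_topology[OF top]
  proof (intro ballI impI)
    fix S assume "S \<in> {{y. R r x y} | r x. True}" "l \<in> S"
    then obtain r x where S: "S = {y. R r x y}" and x: "R r x l" by blast
    from R have "\<forall>\<^sub>F n in F. R r (f n) l" ..
    then show "\<forall>\<^sub>F n in F. f n \<in> S"
      by (rule eventually_mono) (use trans[OF x sym] in \<open>simp add: S\<close>)
  qed
qed

lemma tendsto_rooted_graph_iff:
  "(X \<longlongrightarrow> Y) F \<longleftrightarrow> (\<forall>r. \<forall>\<^sub>F n in F. same_ball r (X n) Y)"
  by (rule tendsto_generated_by_equiv[where R = same_ball, OF open_rooted_graph_def])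
     (fact same_ball_refl same_ball_sym same_ball_trans)+

lemma tendsto_birooted_graph_iff:
  "(X \<longlongrightarrow> Y) F \<longleftrightarrow> (\<forall>r. \<forall>\<^sub>F n in F. same_biball r (X n) Y)"
  by (rule tendsto_generated_by_equiv[where R = same_biball, OF open_birooted_graph_def])
     (fact same_biball_refl same_biball_sym same_biball_trans)+


subsection \<open>Properties and functionals of rooted graphs\<close>

lift_definition root_deg :: "rooted_graph \<Rightarrow> nat" is "\<lambda>(G, x). deg G x"
  by (elim conjE rooted_isoE) (auto simp: graph_iso_deg)

lift_definition is_tree :: "rooted_graph \<Rightarrow> bool" is
  "\<lambda>(G, x). connected_graph G \<and> acyclic_graph G"
  by (elim conjE rooted_isoE) (auto intro: graph_iso_acyclic graph_iso_inv(1))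

lift_definition no_leaves :: "rooted_graph \<Rightarrow> bool" is
  "\<lambda>(G, x). \<forall>v\<in>verts G. deg G v \<ge> 2"
  by (elim conjE rooted_isoE) (auto simp: graph_iso_deg simp flip: graph_isoD(3))

lift_definition deg_bounded :: "nat \<Rightarrow> rooted_graph \<Rightarrow> bool" is
  "\<lambda>\<Delta> (G, x). \<forall>v\<in>verts G. deg G v \<le> \<Delta>"
  by (elim conjE rooted_isoE) (auto simp: graph_iso_deg simp flip: graph_isoD(3))

lift_definition num_closed_walks :: "nat \<Rightarrow> rooted_graph \<Rightarrow> nat" is
  "\<lambda>k (G, x). card (closed_walks k G x)"
  by (elim conjE rooted_isoE) (auto simp: graph_iso_card_closed_walks)

lift_definition return_prob :: "nat \<Rightarrow> rooted_graph \<Rightarrow> real" is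
  "\<lambda>k (G, x). pmf (srw G x k) x"
  by (elim conjE rooted_isoE) (auto simp: graph_iso_return_prob)


section \<open>Unimodular networks\<close>

lemma abs_birooted_graph_eqI:
  "valid_birooted P \<Longrightarrow> valid_birooted Q \<Longrightarrow> birooted_iso P Q \<Longrightarrow>
   abs_birooted_graph P = abs_birooted_graph Q"
  by (simp add: Quotient_rel_abs[OF Quotient_birooted_graph])

lemma abs_birooted_graph_iso:
  assumes "graph_iso g G H" "valid_rooted (G, x)" "valid_rooted (H, g x)" "v \<in> verts G"
  shows "abs_birooted_graph (G, x, v) = abs_birooted_graph (H, g x, g v)"
    and "abs_birooted_graph (G, v, x) = abs_birooted_graph (H, g v, g x)"
  using assms graph_isoD(5)[OF assms(1)] by (auto intro!: abs_birooted_graph_eqI)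

lift_definition mass_out :: "(birooted_graph \<Rightarrow> ennreal) \<Rightarrow> rooted_graph \<Rightarrow> ennreal" is
  "\<lambda>f (G, x). \<integral>\<^sup>+ y. f (abs_birooted_graph (G, x, y)) \<partial>count_space (verts G)"
proof (clarify, unfold rooted_iso.simps, elim exE conjE)
  fix f G H g and x y :: nat
  assume v: "valid_rooted (G, x)" "valid_rooted (H, y)" and g: "graph_iso g G H" "g x = y"
  then show "(\<integral>\<^sup>+ v. f (abs_birooted_graph (G, x, v)) \<partial>count_space (verts G)) =
             (\<integral>\<^sup>+ v. f (abs_birooted_graph (H, y, v)) \<partial>count_space (verts H))"
    by (subst nn_integral_bij_count_space[OF graph_isoD(1)[OF g(1)], symmetric])
       (auto intro!: nn_integral_cong simp: abs_birooted_graph_iso(1)[OF g(1)]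
          simp del: valid_rooted.simps)
qed

lift_definition mass_in :: "(birooted_graph \<Rightarrow> ennreal) \<Rightarrow> rooted_graph \<Rightarrow> ennreal" is
  "\<lambda>f (G, x). \<integral>\<^sup>+ y. f (abs_birooted_graph (G, y, x)) \<partial>count_space (verts G)"
proof (clarify, unfold rooted_iso.simps, elim exE conjE)
  fix f G H g and x y :: nat
  assume v: "valid_rooted (G, x)" "valid_rooted (H, y)" and g: "graph_iso g G H" "g x = y"
  then show "(\<integral>\<^sup>+ v. f (abs_birooted_graph (G, v, x)) \<partial>count_space (verts G)) =
             (\<integral>\<^sup>+ v. f (abs_birooted_graph (H, v, y)) \<partial>count_space (verts H))"
    by (subst nn_integral_bij_count_space[OF graph_isoD(1)[OF g(1)], symmetric])
       (auto intro!: nn_integral_cong simp: abs_birooted_graph_iso(2)[OF g(1)]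
          simp del: valid_rooted.simps)
qed

definition unimodular_network :: "'a measure \<Rightarrow> ('a \<Rightarrow> rooted_graph) \<Rightarrow> bool" where
  "unimodular_network M T \<longleftrightarrow>
     prob_space M \<and> T \<in> borel_measurable M \<and>
     (\<forall>f \<in> borel_measurable borel.
        (\<integral>\<^sup>+ \<omega>. mass_out f (T \<omega>) \<partial>M) = (\<integral>\<^sup>+ \<omega>. mass_in f (T \<omega>) \<partial>M))"


section \<open>Spectral radii\<close>

definition ennreal_root :: "nat \<Rightarrow> ennreal \<Rightarrow> ennreal" where
  "ennreal_root n x = (if x = \<infinity> then \<infinity> else ennreal (root n (enn2real x)))"

definition ennreal_exp :: "ennreal \<Rightarrow> ennreal" where
  "ennreal_exp x = (if x = \<infinity> then \<infinity> else ennreal (exp (enn2real x)))"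

definition spectral_radius :: "'a measure \<Rightarrow> ('a \<Rightarrow> rooted_graph) \<Rightarrow> ennreal" where
  "spectral_radius M T =
     lim (\<lambda>k. ennreal_root (2 * k) (\<integral>\<^sup>+ \<omega>. of_nat (num_closed_walks (2 * k) (T \<omega>)) \<partial>M))"

definition srw_spectral_radius :: "'a measure \<Rightarrow> ('a \<Rightarrow> rooted_graph) \<Rightarrow> real" where
  "srw_spectral_radius M T =
     lim (\<lambda>k. root (2 * k) (\<integral>\<omega>. return_prob (2 * k) (T \<omega>) \<partial>M))"

end

theory Submission
  imports Defs "HOL-Computational_Algebra.Formal_Power_Series"
begin

text \<open>
  Following Hoory, closed walks are generated by Dyck paths: at each up-step one chooses a
  neighbour other than the parent. Weight each visit to a vertex by \<open>u\<close> of its degree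
  (\<open>u = 1\<close> for counting walks, \<open>u = \<Delta> / deg\<close> for the random walk) and let \<open>F k x y\<close> be the weight
  of the walks of length \<open>2 k\<close> at \<open>y\<close> below the parent \<open>x\<close>. The uniform non-backtracking step
  preserves the degree-biased law of the root edge, by mass transport; so Jensen's inequality,
  with weights \<open>c\<^sub>i c\<^sub>k\<^sub>-\<^sub>i / c\<^sub>k\<^sub>+\<^sub>1\<close> given by the Catalan numbers \<open>c\<close>, shows by induction that the biased mean
  of \<open>ln (F k x y)\<close> is at least \<open>ln c\<^sub>k + k l\<close>, where \<open>l\<close> is the biased mean of
  \<open>ln (deg - 1) + 2 ln u\<close>. A further Jensen step bounds the moments \<open>E[W\<^sub>2\<^sub>k]\<close> from below, the factor
  \<open>deg\<close> of the bias being absorbed by \<open>deg W\<^sub>2\<^sub>k \<le> W\<^sub>2\<^sub>k\<^sub>+\<^sub>2\<close>, and \<open>c\<^sub>k\<close> grows like \<open>4\<^sup>k\<close>. The limits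
  exist because the moments are log-convex.
\<close>

section \<open>Weighted walks\<close>

text \<open>The recursion for \<open>F (Suc k) x y\<close> sums products
  \<open>F i y z * F (k - i) x y\<close> over children \<open>z\<close>, so it mixes the edge
  \<open>x y\<close> with the next edge \<open>y z\<close>. The Catalan weights are the exact
  proportions of the summands in a regular tree, where this Jensen step loses nothing. The biased
  mean of \<open>ln (deg - 1)\<close> may be infinite. All means are therefore taken in
  \<open>ennreal\<close>, which asks for nonnegative logarithms throughout and hence for weights at
  least 1. Counting walks has this with \<open>u = 1\<close>; the natural random-walk weight
  \<open>1 / deg\<close> does not, and multiplying it by the degree bound \<open>\<Delta>\<close>
  repairs this at the cost of a factor \<open>\<Delta>\<close> per step, divided out at the
  end.\<close>

primrec walk_weight :: "(nat \<Rightarrow> real) \<Rightarrow> 'v graph \<Rightarrow> nat \<Rightarrow> 'v \<Rightarrow> 'v \<Rightarrow> real" where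
  "walk_weight u G 0 x y = (if x = y then 1 else 0)"
| "walk_weight u G (Suc n) x y = u (deg G x) * (\<Sum>z\<in>nbrs G x. walk_weight u G n z y)"

text \<open>For an edge \<open>x y\<close> of a tree, the weight of the closed walks of length \<open>2 k\<close> at \<open>y\<close> that avoid
  \<open>x\<close>: the first step goes to \<open>z\<close>, and the walk first returns to \<open>y\<close> after \<open>2 i + 2\<close> steps.\<close>

fun branch_weight :: "(nat \<Rightarrow> real) \<Rightarrow> 'v graph \<Rightarrow> nat \<Rightarrow> 'v \<Rightarrow> 'v \<Rightarrow> real" where
  "branch_weight u G 0 x y = 1"
| "branch_weight u G (Suc k) x y =
     (\<Sum>i\<le>k. \<Sum>z\<in>nbrs G y - {x}. u (deg G y) * u (deg G z) *
        branch_weight u G i y z * branch_weight u G (k - i) x y)"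

text \<open>A stack \<open>v\<^sub>h, \<dots>, v\<^sub>1\<close> above \<open>y\<close> records a path from \<open>y\<close>; \<open>stack_fps\<close> counts the ways of emptying it
  by steps that pop the top or push a neighbour of the top other than the element below it.
  All these steps lead to distinct neighbours of the top, so the count is at most the number of
  walks in the graph.\<close>

definition stack_top :: "'v \<Rightarrow> 'v list \<Rightarrow> 'v" where
  "stack_top y s = (case s of [] \<Rightarrow> y | v # _ \<Rightarrow> v)"

lemma stack_top_simps [simp]: "stack_top y [] = y" "stack_top y (v # s) = v"
  by (simp_all add: stack_top_def)

definition branch_fps :: "(nat \<Rightarrow> real) \<Rightarrow> 'v graph \<Rightarrow> 'v \<Rightarrow> 'v \<Rightarrow> real fps" where
  "branch_fps u G x y = Abs_fps (\<lambda>k. branch_weight u G k x y)"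

primrec stack_fps :: "(nat \<Rightarrow> real) \<Rightarrow> 'v graph \<Rightarrow> 'v \<Rightarrow> 'v \<Rightarrow> 'v list \<Rightarrow> real fps" where
  "stack_fps u G x y [] = branch_fps u G x y"
| "stack_fps u G x y (v # s) =
     branch_fps u G (stack_top y s) v * fps_const (u (deg G v)) * stack_fps u G x y s"

lemma branch_fps_rec:
  "branch_fps u G x y = 1 + fps_X * ((\<Sum>z\<in>nbrs G y - {x}.
     fps_const (u (deg G y) * u (deg G z)) * branch_fps u G y z) * branch_fps u G x y)"
proof (rule fps_ext)
  fix n
  show "fps_nth (branch_fps u G x y) n = fps_nth (1 + fps_X * ((\<Sum>z\<in>nbrs G y - {x}.
     fps_const (u (deg G y) * u (deg G z)) * branch_fps u G y z) * branch_fps u G x y)) n"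
  proof (cases n)
    case (Suc k)
    have "fps_nth (1 + fps_X * ((\<Sum>z\<in>nbrs G y - {x}.
        fps_const (u (deg G y) * u (deg G z)) * branch_fps u G y z) * branch_fps u G x y)) n =
      (\<Sum>z\<in>nbrs G y - {x}. fps_nth (fps_const (u (deg G y) * u (deg G z)) *
        (branch_fps u G y z * branch_fps u G x y)) k)"
      unfolding Suc sum_distrib_right by (simp add: fps_sum_nth mult.assoc)
    also have "\<dots> = (\<Sum>z\<in>nbrs G y - {x}. \<Sum>i\<le>k. u (deg G y) * u (deg G z) *
        branch_weight u G i y z * branch_weight u G (k - i) x y)"
      unfolding fps_mult_left_const_nth unfolding fps_mult_nth atMost_atLeast0
      by (simp add: branch_fps_def sum_distrib_left mult.assoc)
    also have "\<dots> = fps_nth (branch_fps u G x y) n"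
      by (subst sum.swap) (simp add: branch_fps_def Suc)
    finally show ?thesis ..
  qed (simp add: branch_fps_def)
qed

lemma stack_fps_Nil_rec:
  "stack_fps u G x y [] = 1 + fps_const (u (deg G y)) * fps_X *
     (\<Sum>z\<in>nbrs G y - {x}. stack_fps u G x y [z])"
  unfolding stack_fps.simps
  by (subst branch_fps_rec)
     (simp add: sum_distrib_left sum_distrib_right mult_ac flip: fps_const_mult)

text \<open>The product defining \<open>stack_fps\<close> is a first-passage decomposition:
  excursions above the top, then its removal. Unfolding the topmost branch series once turns it into
  single steps, a pop or a push, each paid with \<open>u\<close> at the vertex it leaves, as in
  \<open>walk_weight\<close>. Only pushes carry \<open>fps_X\<close>.\<close>

lemma stack_fps_Cons_rec:
  "stack_fps u G x y (v # s) = fps_const (u (deg G v)) * (stack_fps u G x y s +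
     fps_X * (\<Sum>z\<in>nbrs G v - {stack_top y s}. stack_fps u G x y (z # v # s)))"
proof -
  have "stack_fps u G x y (v # s) =
     branch_fps u G (stack_top y s) v * (fps_const (u (deg G v)) * stack_fps u G x y s)"
    by (simp add: mult_ac)
  also have "\<dots> = fps_const (u (deg G v)) * (stack_fps u G x y s +
     fps_X * (\<Sum>z\<in>nbrs G v - {stack_top y s}. stack_fps u G x y (z # v # s)))"
    by (subst branch_fps_rec)
       (simp add: sum_distrib_left sum_distrib_right algebra_simps flip: fps_const_mult)
  finally show ?thesis .
qed

text \<open>Degree at least 2 leaves every edge a continuation that does not backtrack, and weights
  at least 1 then keep the branch weights at least 1, so that their logarithms are
  nonnegative.\<close>

locale weighted_graph =
  fixes u :: "nat \<Rightarrow> real" and G :: "'v graph"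
  assumes simple: "simple_graph G" and fin: "locally_finite G"
    and deg2: "v \<in> verts G \<Longrightarrow> 2 \<le> deg G v"
    and u1: "v \<in> verts G \<Longrightarrow> 1 \<le> u (deg G v)"
begin

abbreviation "K \<equiv> walk_weight u G"
abbreviation "F \<equiv> branch_weight u G"
abbreviation "U v \<equiv> u (deg G v)"

lemma nbrs_sym: "y \<in> nbrs G x \<longleftrightarrow> x \<in> nbrs G y"
  using simple by (auto simp: nbrs_def simple_graph_def dest: symD)

lemma nbrs_verts: "y \<in> nbrs G x \<Longrightarrow> y \<in> verts G" "y \<in> nbrs G x \<Longrightarrow> x \<in> verts G"
  using simple by (auto simp: nbrs_def simple_graph_def)

lemma finite_nbrs: "finite (nbrs G x)"
proof (cases "x \<in> verts G")
  case False
  then have "nbrs G x = {}" using nbrs_verts(2) by blast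
  then show ?thesis by simp
qed (use fin in \<open>simp add: locally_finite_def\<close>)

lemma U_pos: "v \<in> verts G \<Longrightarrow> 0 < U v"
  using u1[of v] by linarith

lemma K_nonneg: "x \<in> verts G \<Longrightarrow> 0 \<le> K n x y"
  by (induction n arbitrary: x)
     (auto intro!: mult_nonneg_nonneg sum_nonneg simp: nbrs_verts(1) less_imp_le[OF U_pos])

text \<open>Induction on the number of steps left: \<open>k\<close> pushes, as many pops to undo
  them, and \<open>length s\<close> pops of the initial stack. Pop and pushes together reach each
  neighbour of the top once; at the empty stack the step to \<open>x\<close> is dropped.\<close>

lemma stack_le_walk:
  assumes "length s + 2 * k = n"
    and "successively (\<lambda>a b. a \<in> nbrs G b) (s @ [y])" "y \<in> verts G"
  shows "fps_nth (stack_fps u G x y s) k \<le> K n (stack_top y s) y"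
  using assms(1,2)
proof (induction n arbitrary: s k)
  case 0
  then show ?case by (simp add: branch_fps_def)
next
  case (Suc n)
  have top: "stack_top y s \<in> verts G"
    using Suc.prems(2) assms(3)
    by (cases s; cases "tl s") (auto intro: nbrs_verts)
  \<comment> \<open>\<open>A\<close> is the excluded neighbour: \<open>{x}\<close> at the empty
    stack, the element below the top otherwise.\<close>
  have push: "(\<Sum>z\<in>nbrs G (stack_top y s) - A. fps_nth (stack_fps u G x y (z # s)) (k - 1)) \<le>
        (\<Sum>z\<in>nbrs G (stack_top y s) - A. K n z y)" if "k \<ge> 1" for A
  proof (rule sum_mono)
    fix z assume "z \<in> nbrs G (stack_top y s) - A"
    then show "fps_nth (stack_fps u G x y (z # s)) (k - 1) \<le> K n z y"
      using Suc.IH[of "z # s" "k - 1"] Suc.prems that by (cases s) auto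
  qed
  show ?case
  proof (cases s)
    case Nil
    then have k: "k \<ge> 1" using Suc.prems by auto
    have "fps_nth (stack_fps u G x y s) k =
        U y * (\<Sum>z\<in>nbrs G y - {x}. fps_nth (stack_fps u G x y [z]) (k - 1))"
      unfolding Nil by (subst stack_fps_Nil_rec)
        (use k in \<open>simp add: mult.assoc fps_sum_nth del: stack_fps.simps\<close>)
    also have "\<dots> \<le> U y * (\<Sum>z\<in>nbrs G y. K n z y)"
      using push[OF k, of "{x}"] U_pos[OF assms(3)] Nil
      by (intro mult_left_mono order.trans[OF _ sum_mono2[of "nbrs G y" "nbrs G y - {x}"]])
         (auto simp: finite_nbrs K_nonneg nbrs_verts simp del: stack_fps.simps)
    finally show ?thesis by (simp add: Nil)
  next
    case (Cons v s')
    let ?p = "stack_top y s'"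
    have p: "?p \<in> nbrs G v"
      using Suc.prems(2) by (cases s') (auto simp: Cons nbrs_sym)
    have v: "v \<in> verts G" using top Cons by simp
    have pop: "fps_nth (stack_fps u G x y s') k \<le> K n ?p y"
      using Suc.IH[of s' k] Suc.prems by (cases s') (auto simp: Cons)
    have "fps_nth (stack_fps u G x y s) k = U v * (fps_nth (stack_fps u G x y s') k +
        (if k = 0 then 0 else \<Sum>z\<in>nbrs G v - {?p}. fps_nth (stack_fps u G x y (z # s)) (k - 1)))"
      unfolding Cons by (subst stack_fps_Cons_rec) (simp add: fps_sum_nth del: stack_fps.simps)
    also have "\<dots> \<le> U v * (K n ?p y + (\<Sum>z\<in>nbrs G v - {?p}. K n z y))"
      using pop push[of "{?p}"] U_pos[OF v] Cons
      by (intro mult_left_mono add_mono)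
         (auto intro!: sum_nonneg simp: K_nonneg nbrs_verts simp del: stack_fps.simps)
    also have "\<dots> = K (Suc n) (stack_top y s) y"
      using p by (simp add: Cons sum.remove[OF finite_nbrs])
    finally show ?thesis .
  qed
qed

lemma branch_le_walk: "y \<in> verts G \<Longrightarrow> F k x y \<le> K (2 * k) y y"
  using stack_le_walk[of "[]" k "2 * k" y x] by (simp add: branch_fps_def)

lemma F_ge_1: "y \<in> verts G \<Longrightarrow> 1 \<le> F k x y"
proof (induction k arbitrary: x y rule: less_induct)
  case (less k)
  show ?case
  proof (cases k)
    case (Suc n)
    have "card (nbrs G y) \<ge> 2" using deg2[OF less.prems] by (simp add: deg_def)
    then have "nbrs G y - {x} \<noteq> {}"
      using card_mono[of "{x}" "nbrs G y"] by auto
    then obtain z where z: "z \<in> nbrs G y - {x}" by blast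
    let ?f = "\<lambda>i z. U y * U z * F i y z * F (n - i) x y"
    have pos: "1 \<le> ?f i z" if "i \<le> n" "z \<in> nbrs G y - {x}" for i z
    proof -
      have "z \<in> verts G" using that nbrs_verts by blast
      then have "1 \<le> U y" "1 \<le> U z" "1 \<le> F i y z" "1 \<le> F (n - i) x y"
        using less that Suc u1 by auto
      then show ?thesis by (auto intro!: mult_ge1_I)
    qed
    \<comment> \<open>All summands are at least 1, so a single one suffices.\<close>
    have "1 \<le> ?f 0 z" using pos z by blast
    also have "\<dots> \<le> (\<Sum>z\<in>nbrs G y - {x}. ?f 0 z)"
      using pos z by (intro member_le_sum) (force simp: finite_nbrs)+
    also have "\<dots> \<le> (\<Sum>i\<le>n. \<Sum>z\<in>nbrs G y - {x}. ?f i z)"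
      using pos by (intro member_le_sum[of 0 "{..n}" "\<lambda>i. \<Sum>z\<in>nbrs G y - {x}. ?f i z"])
        (force intro!: sum_nonneg)+
    finally show ?thesis using Suc by simp
  qed simp
qed

section \<open>Reversibility, composition and log-convexity of walk weights\<close>

lemma K_last:
  assumes "y \<in> verts G"
  shows "K (Suc n) x y = (\<Sum>z\<in>nbrs G y. K n x z * U z)"
proof (induction n arbitrary: x)
  case 0
  show ?case using nbrs_sym[of x y] by (simp add: finite_nbrs if_distrib[of "\<lambda>t. t * _"] cong: if_cong)
next
  case (Suc n)
  have "K (Suc (Suc n)) x y = U x * (\<Sum>w\<in>nbrs G x. \<Sum>z\<in>nbrs G y. K n w z * U z)"
    using Suc by (simp del: walk_weight.simps add: walk_weight.simps(2)[of _ _ "Suc n"])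
  also have "\<dots> = (\<Sum>z\<in>nbrs G y. K (Suc n) x z * U z)"
    by (subst sum.swap) (simp add: sum_distrib_left sum_distrib_right mult_ac)
  finally show ?case .
qed

text \<open>\<open>K n x y\<close> carries \<open>u\<close> at every vertex of a walk except the
  last. The missing factor at \<open>y\<close> gives a weight that does not see the direction of the
  walk.\<close>

lemma K_reversible:
  assumes "x \<in> verts G" "y \<in> verts G"
  shows "K n x y * U y = U x * K n y x"
  using assms
proof (induction n arbitrary: x y)
  case (Suc n)
  have "K (Suc n) x y * U y = U x * (\<Sum>z\<in>nbrs G x. K n z y * U y)"
    by (simp add: sum_distrib_right mult.assoc)
  also have "\<dots> = U x * (\<Sum>z\<in>nbrs G x. U z * K n y z)"
    using Suc nbrs_verts by (auto intro!: sum.cong arg_cong2[where f = "(*)"])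
  also have "\<dots> = U x * K (Suc n) y x"
    using K_last[OF Suc.prems(1)] by (simp add: mult_ac del: walk_weight.simps)
  finally show ?case .
qed simp

lemma finite_near: "finite (near_set G {x} n)"
proof -
  have *: "finite {y. (x, y) \<in> edges G ^^ k}" for k
  proof (induction k)
    case (Suc k)
    have "{y. (x, y) \<in> edges G ^^ Suc k} = (\<Union>z\<in>{y. (x, y) \<in> edges G ^^ k}. nbrs G z)"
      by (auto simp: nbrs_def)
    then show ?case using Suc finite_nbrs by auto
  qed simp
  have "near_set G {x} n = (\<Union>k\<le>n. {y. (x, y) \<in> edges G ^^ k})"
    by (auto simp: near_set_def)
  then show ?thesis using * by simp
qed

lemma near_step:
  assumes "w \<in> nbrs G x" shows "near_set G {w} n \<subseteq> near_set G {x} (Suc n)"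
proof
  fix y assume "y \<in> near_set G {w} n"
  then obtain k where "k \<le> n" "(w, y) \<in> edges G ^^ k" by (auto simp: near_set_def)
  then have "Suc k \<le> Suc n" "(x, y) \<in> edges G ^^ Suc k"
    using assms relpow_Suc_I2[of x w "edges G" y k] by (auto simp: nbrs_def simp del: relpow.simps)
  then show "y \<in> near_set G {x} (Suc n)" unfolding near_set_def by blast
qed

lemma near_verts: "x \<in> verts G \<Longrightarrow> near_set G {x} n \<subseteq> verts G"
proof
  fix y assume x: "x \<in> verts G" and "y \<in> near_set G {x} n"
  then obtain k where "(x, y) \<in> edges G ^^ k" by (auto simp: near_set_def)
  then show "y \<in> verts G" using x simple by (cases k) (auto simp: simple_graph_def)
qed

text \<open>Walks of length \<open>a\<close> stay in the ball, so any finite set containing it may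
  index the midpoints. The freedom in \<open>S\<close> lets walks of two different lengths be summed
  over one common set.\<close>

lemma K_add:
  assumes "finite S" "near_set G {x} a \<subseteq> S"
  shows "K (a + b) x y = (\<Sum>z\<in>S. K a x z * K b z y)"
  using assms(2)
proof (induction a arbitrary: x)
  case 0
  then have "x \<in> S" by (auto simp: near_set_def)
  then show ?case using assms(1) by (simp add: if_distrib[of "\<lambda>t. t * _"] cong: if_cong)
next
  case (Suc a)
  have "K (Suc a + b) x y = U x * (\<Sum>w\<in>nbrs G x. \<Sum>z\<in>S. K a w z * K b z y)"
    using Suc.IH near_step Suc.prems by (auto intro!: sum.cong) blast
  also have "\<dots> = (\<Sum>z\<in>S. K (Suc a) x z * K b z y)"
    by (subst sum.swap) (simp add: sum_distrib_left sum_distrib_right mult_ac)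
  finally show ?case .
qed

lemma K_log_convex:
  assumes x: "x \<in> verts G"
  shows "(K (a + b) x x)\<^sup>2 \<le> K (2 * a) x x * K (2 * b) x x"
proof -
  let ?S = "near_set G {x} a \<union> near_set G {x} b"
  \<comment> \<open>By reversibility \<open>K n z x\<close> is \<open>K n x z * (U z / U x)\<close>.
    Giving half of the last factor to each side turns the sum over midpoints into an inner product,
    ready for Cauchy-Schwarz.\<close>
  let ?g = "\<lambda>n z. K n x z * sqrt (U z / U x)"
  have S: "finite ?S" "?S \<subseteq> verts G" using finite_near near_verts[OF x] by auto
  have *: "K (m + n) x x = (\<Sum>z\<in>?S. ?g m z * ?g n z)" if "m \<in> {a, b}" for m n
  proof -
    have "K (m + n) x x = (\<Sum>z\<in>?S. K m x z * K n z x)"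
      using that S by (intro K_add) auto
    also have "\<dots> = (\<Sum>z\<in>?S. ?g m z * ?g n z)"
    proof (rule sum.cong)
      fix z assume "z \<in> ?S"
      then have z: "z \<in> verts G" using S by blast
      then have "K n z x = K n x z * (U z / U x)"
        using K_reversible[OF x z, of n] U_pos[OF x] by (simp add: field_simps)
      moreover have "sqrt (U z / U x) * sqrt (U z / U x) = U z / U x"
        using U_pos[OF x] U_pos[OF z] by simp
      ultimately show "K m x z * K n z x = ?g m z * ?g n z"
        by (simp add: mult_ac)
    qed simp
    finally show ?thesis .
  qed
  show ?thesis
    using Cauchy_Schwarz_ineq_sum[of "?g a" "?g b" ?S] *[of a b] *[of a a] *[of b b]
    by (simp add: power2_eq_square mult_2)
qed

text \<open>A detour \<open>x\<close>, \<open>z\<close>, \<open>x\<close> through a neighbour has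
  weight at least 1; prepending all these detours to the closed walks yields the factor
  \<open>deg G x\<close>.\<close>

lemma deg_mult_K_le:
  assumes x: "x \<in> verts G"
  shows "real (deg G x) * K (2 * k) x x \<le> K (2 * Suc k) x x"
proof -
  have "real (deg G x) = (\<Sum>z\<in>nbrs G x. 1)" by (simp add: deg_def)
  also have "\<dots> \<le> (\<Sum>z\<in>nbrs G x. U x * U z)"
    using u1[OF x] u1[OF nbrs_verts(1)] by (intro sum_mono mult_ge1_I)
  also have "\<dots> = U x * (\<Sum>z\<in>nbrs G x. K 1 z x)"
    unfolding sum_distrib_left using nbrs_sym[of _ x] by (intro sum.cong) (auto simp: finite_nbrs)
  finally have "real (deg G x) \<le> K 2 x x" by (simp add: numeral_2_eq_2)
  then have "real (deg G x) * K (2 * k) x x \<le> K 2 x x * K (2 * k) x x"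
    using K_nonneg[OF x] by (rule mult_right_mono)
  also have "\<dots> \<le> (\<Sum>z\<in>near_set G {x} 2. K 2 x z * K (2 * k) z x)"
  proof (rule member_le_sum)
    show "x \<in> near_set G {x} 2" by (auto simp: near_set_def)
    show "0 \<le> K 2 x z * K (2 * k) z x" if "z \<in> near_set G {x} 2 - {x}" for z
      using that near_verts[OF x] K_nonneg x by (blast intro: mult_nonneg_nonneg)
  qed (rule finite_near)
  also have "\<dots> = K (2 * Suc k) x x"
    using K_add[OF finite_near order.refl, where x = x and a = 2 and b = "2 * k" and y = x] by simp
  finally show ?thesis .
qed

lemma K_even_ge_1:
  assumes "x \<in> verts G" shows "1 \<le> K (2 * k) x x"
  using branch_le_walk[OF assms] F_ge_1[OF assms] order.trans by blast

end

section \<open>Catalan numbers and Jensen's inequality\<close>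

fun catalan :: "nat \<Rightarrow> real" where
  "catalan 0 = 1"
| "catalan (Suc k) = (\<Sum>i\<le>k. catalan i * catalan (k - i))"

lemma catalan_ge_1: "1 \<le> catalan k"
proof (induction k rule: less_induct)
  case (less k)
  show ?case
  proof (cases k)
    case (Suc n)
    have *: "1 \<le> catalan i * catalan (n - i)" if "i \<le> n" for i
      using that less Suc by (intro mult_ge1_I) auto
    have "1 \<le> catalan 0 * catalan (n - 0)" using *[of 0] by simp
    also have "\<dots> \<le> (\<Sum>i\<le>n. catalan i * catalan (n - i))"
      using * by (intro member_le_sum[of 0 "{..n}" "\<lambda>i. catalan i * catalan (n - i)"]) force+
    finally show ?thesis using Suc by simp
  qed simp
qed

text \<open>Inside the radius of convergence the generating function solves \<open>x S\<^sup>2 - S + 1 = 0\<close>,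
  whose discriminant \<open>1 - 4 x\<close> must be nonnegative.\<close>

lemma catalan_growth:
  assumes bound: "\<And>k. catalan k \<le> A * r ^ k" and r: "0 \<le> r"
  shows "4 \<le> r"
proof (rule ccontr)
  assume "\<not> 4 \<le> r"
  \<comment> \<open>The reciprocal of the mean of \<open>r\<close> and 4, hence
    \<open>4 * x > 1\<close> and \<open>r * x < 1\<close>; the case \<open>r = 0\<close> is
    covered.\<close>
  define x where "x = 2 / (r + 4)"
  have x: "0 < x" "1 < 4 * x" "0 \<le> r * x" "r * x < 1"
    using r \<open>\<not> 4 \<le> r\<close> by (auto simp: x_def field_simps)
  define a where "a k = catalan k * x ^ k" for k
  have a: "0 \<le> a k" "norm (a k) \<le> A * (r * x) ^ k" for k
    using catalan_ge_1[of k] mult_right_mono[OF bound[of k], of "x ^ k"] x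
    by (auto simp: a_def power_mult_distrib mult_ac)
  have summable: "summable (\<lambda>k. norm (a k))"
    by (rule summable_comparison_test'[of "\<lambda>k. A * (r * x) ^ k" 0])
       (use a x in \<open>auto intro!: summable_mult summable_geometric\<close>)
  define S where "S = (\<Sum>k. a k)"
  have "(\<lambda>k. x * (\<Sum>i\<le>k. a i * a (k - i))) sums (x * (S * S))"
    unfolding S_def by (intro sums_mult Cauchy_product_sums summable)
  moreover have "x * (\<Sum>i\<le>k. a i * a (k - i)) = a (Suc k)" for k
  proof -
    have "a i * a (k - i) = catalan i * catalan (k - i) * x ^ k" if "i \<le> k" for i
    proof -
      have x: "x ^ i * x ^ (k - i) = x ^ k" using that by (simp flip: power_add)
      show ?thesis by (simp only: a_def x[symmetric] mult_ac)
    qed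
    then have "(\<Sum>i\<le>k. a i * a (k - i)) = catalan (Suc k) * x ^ k"
      by (simp flip: sum_distrib_right)
    then show ?thesis by (simp add: a_def)
  qed
  ultimately have "(\<lambda>k. a (Suc k)) sums (x * (S * S))"
    by simp
  then have "a sums (x * (S * S) + a 0)" by (simp add: sums_Suc_iff)
  then have "S = x * (S * S) + 1" by (simp add: sums_iff a_def[of 0] flip: S_def)
  then have "(2 * x * S - 1)\<^sup>2 = 1 - 4 * x"
    by algebra
  then show False using x(2) zero_le_power2[of "2 * x * S - 1"] by linarith
qed

text \<open>Jensen's inequality for \<open>ln\<close> in entropy form, with equality when
  \<open>p\<close> is proportional to \<open>a\<close>. It comes from
  \<open>ln t \<le> t - 1\<close> at \<open>t = a i / (p i * sum a S)\<close>.\<close>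

lemma ln_sum_ge:
  fixes a p :: "'i \<Rightarrow> real"
  assumes "finite S" and a: "\<And>i. i \<in> S \<Longrightarrow> 0 < a i" and p: "\<And>i. i \<in> S \<Longrightarrow> 0 < p i"
    and p1: "sum p S = 1"
  shows "(\<Sum>i\<in>S. p i * (ln (a i) - ln (p i))) \<le> ln (sum a S)"
proof -
  let ?A = "sum a S"
  have "S \<noteq> {}" using p1 by auto
  then have A: "0 < ?A" using assms by (intro sum_pos) auto
  have "(\<Sum>i\<in>S. p i * (ln (a i) - ln (p i) - ln ?A)) \<le> (\<Sum>i\<in>S. p i * (a i / (p i * ?A) - 1))"
  proof (intro sum_mono mult_left_mono)
    fix i assume i: "i \<in> S"
    have "ln (a i) - ln (p i) - ln ?A = ln (a i / (p i * ?A))"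
      using a[OF i] p[OF i] A by (simp add: ln_div ln_mult)
    also have "\<dots> \<le> a i / (p i * ?A) - 1"
      using a[OF i] p[OF i] A by (intro ln_le_minus_one) simp
    finally show "ln (a i) - ln (p i) - ln ?A \<le> a i / (p i * ?A) - 1" .
  qed (use p in \<open>auto intro: less_imp_le\<close>)
  also have "\<dots> = (\<Sum>i\<in>S. a i / ?A - p i)"
    using p A by (intro sum.cong) (auto simp: field_simps dest: less_imp_neq[THEN not_sym])
  also have "\<dots> = 0"
    using A p1 by (simp add: sum_subtractf flip: sum_divide_distrib)
  finally show ?thesis
    using p1 by (simp add: right_diff_distrib sum_subtractf flip: sum_distrib_right)
qed

text \<open>The law of the size of the first arch in a uniform Dyck path with \<open>k + 1\<close>
  up-steps: \<open>i\<close> up-steps under the arch and \<open>k - i\<close> after it.\<close>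

definition catalan_split :: "nat \<Rightarrow> nat \<Rightarrow> real" where
  "catalan_split k i = catalan i * catalan (k - i) / catalan (Suc k)"

text \<open>The last identity closes the later induction: for each single \<open>i\<close>, not
  merely on average, the two inductive bounds and the entropy term
  \<open>- ln (catalan_split k i)\<close> add up to \<open>ln (catalan (Suc k))\<close>.\<close>

lemma catalan_split:
  shows "(\<Sum>i\<le>k. catalan_split k i) = 1"
    and "0 < catalan_split k i"
    and "i \<le> k \<Longrightarrow> catalan_split k i \<le> 1"
    and "ln (catalan i) + ln (catalan (k - i)) - ln (catalan_split k i) = ln (catalan (Suc k))"
proof -
  have pos: "0 < catalan j" for j using catalan_ge_1[of j] by linarith
  show sum1: "(\<Sum>i\<le>k. catalan_split k i) = 1"
    using pos[of "Suc k"] by (simp add: catalan_split_def flip: sum_divide_distrib)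
  show gt0: "0 < catalan_split k i" for i
    using pos by (simp add: catalan_split_def del: catalan.simps)
  show "catalan_split k i \<le> 1" if "i \<le> k"
    using member_le_sum[of i "{..k}" "catalan_split k"] that sum1 less_imp_le[OF gt0] by simp
  show "ln (catalan i) + ln (catalan (k - i)) - ln (catalan_split k i) = ln (catalan (Suc k))"
    using pos[of i] pos[of "k - i"] pos[of "Suc k"]
    by (simp add: catalan_split_def ln_div ln_mult del: catalan.simps)
qed

context weighted_graph
begin

text \<open>Jensen's inequality with weight \<open>catalan_split k i / m\<close> on the pair
  \<open>(i, z)\<close>: the Catalan law for the arch, the uniform law on the \<open>m\<close>
  children. The entropy of the uniform law is the term \<open>ln m\<close>. The terms are grouped so
  that each is nonnegative and the inequality can be read in \<open>ennreal\<close>.\<close>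

lemma ln_branch_Suc_ge:
  fixes k :: nat and x y :: 'v
  assumes x: "x \<in> nbrs G y"
  defines "N \<equiv> nbrs G y - {x}" and "m \<equiv> real (deg G y) - 1"
  shows "(ln (U y) + ln m) + (\<Sum>z\<in>N. ln (U z)) / m +
      (\<Sum>i\<le>k. catalan_split k i * ((\<Sum>z\<in>N. ln (F i y z)) / m + ln (F (k - i) x y) +
        (- ln (catalan_split k i)))) \<le> ln (F (Suc k) x y)"
proof -
  let ?w = "catalan_split k"
  have y: "y \<in> verts G" using x nbrs_verts by blast
  have N: "finite N" "real (card N) = m" "1 \<le> m"
    using x deg2[OF y] by (auto simp: N_def m_def finite_nbrs deg_def of_nat_diff)
  have NV: "z \<in> verts G" if "z \<in> N" for z using that nbrs_verts by (auto simp: N_def)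
  have pos: "0 < F i a b" if "b \<in> verts G" for i a b using F_ge_1[OF that, of i a] by linarith
  let ?a = "\<lambda>(i, z). U y * U z * F i y z * F (k - i) x y" and ?p = "\<lambda>(i, z). ?w i / m"
  have const: "(\<Sum>z\<in>N. t / m) = t" for t using N by simp
  have "(\<Sum>s\<in>{..k} \<times> N. ?p s * (ln (?a s) - ln (?p s))) \<le> ln (sum ?a ({..k} \<times> N))"
  proof (rule ln_sum_ge)
    show "finite ({..k} \<times> N)" using N by simp
    show "0 < ?a s" if "s \<in> {..k} \<times> N" for s
      using that NV y pos U_pos by (auto intro!: mult_pos_pos)
    show "0 < ?p s" if "s \<in> {..k} \<times> N" for s
      using N catalan_split(2) by (auto split: prod.split)
    show "sum ?p ({..k} \<times> N) = 1"
      using catalan_split(1)[of k] by (simp add: const del: sum_constant flip: sum.cartesian_product)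
  qed
  also have "sum ?a ({..k} \<times> N) = F (Suc k) x y"
    by (simp add: N_def flip: sum.cartesian_product)
  also have "(\<Sum>s\<in>{..k} \<times> N. ?p s * (ln (?a s) - ln (?p s))) =
      (\<Sum>i\<le>k. \<Sum>z\<in>N. ?w i * ((ln (U y) + ln m) / m + ln (U z) / m +
        (ln (F i y z) / m + (ln (F (k - i) x y) - ln (?w i)) / m)))"
    unfolding sum.cartesian_product
  proof (rule sum.cong[OF refl], clarify)
    fix i z assume "z \<in> N"
    then have z: "z \<in> verts G" by (rule NV)
    have "ln (U y * U z * F i y z * F (k - i) x y) =
        ln (U y) + ln (U z) + ln (F i y z) + ln (F (k - i) x y)"
      using U_pos[OF y] U_pos[OF z] pos[OF y, of "k - i" x] pos[OF z, of i y] by (simp add: ln_mult)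
    moreover have "ln (?w i / m) = ln (?w i) - ln m"
      using catalan_split(2)[of k i] N(3) by (simp add: ln_div)
    ultimately have "ln (U y * U z * F i y z * F (k - i) x y) - ln (?w i / m) =
        ln (U y) + ln m + ln (U z) + ln (F i y z) + (ln (F (k - i) x y) - ln (?w i))"
      by simp
    then show "?w i / m * (ln (U y * U z * F i y z * F (k - i) x y) - ln (?w i / m)) =
       ?w i * ((ln (U y) + ln m) / m + ln (U z) / m +
        (ln (F i y z) / m + (ln (F (k - i) x y) - ln (?w i)) / m))"
      by (simp only: add_divide_distrib[symmetric]) (simp add: algebra_simps add_divide_distrib diff_divide_distrib)
  qed
  also have "\<dots> = (\<Sum>i\<le>k. ?w i * ((ln (U y) + ln m) + (\<Sum>z\<in>N. ln (U z)) / m +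
        ((\<Sum>z\<in>N. ln (F i y z)) / m + ln (F (k - i) x y) + (- ln (?w i)))))"
    unfolding sum_distrib_left[symmetric] sum.distrib const
    by (simp add: sum_divide_distrib add.assoc diff_conv_add_uminus del: add_uminus_conv_diff)
  also have "\<dots> = (ln (U y) + ln m) + (\<Sum>z\<in>N. ln (U z)) / m +
      (\<Sum>i\<le>k. ?w i * ((\<Sum>z\<in>N. ln (F i y z)) / m + ln (F (k - i) x y) + (- ln (?w i))))"
    using catalan_split(1)[of k] by (simp only: distrib_left[of "?w _" "_ + _ / _"] sum.distrib)
       (simp flip: sum_distrib_right)
  finally show ?thesis .
qed

end

section \<open>Closed walks and return probabilities as walk weights\<close>

lemma card_walks:
  fixes G :: "'v graph"
  assumes "simple_graph G" "locally_finite G"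
  defines "W \<equiv> \<lambda>n x y. {w. length w = Suc n \<and> hd w = x \<and> last w = y \<and>
    successively (\<lambda>u v. (u, v) \<in> edges G) w}"
  shows "x \<in> verts G \<Longrightarrow> finite (W n x y) \<and> real (card (W n x y)) = walk_weight (\<lambda>_. 1) G n x y"
proof (induction n arbitrary: x)
  case 0
  have "W 0 x y = (if x = y then {[x]} else {})"
    by (auto simp: W_def length_Suc_conv)
  then show ?case by simp
next
  case (Suc n)
  have fin: "finite (nbrs G x)" using assms Suc.prems by (simp add: locally_finite_def)
  have sub: "z \<in> verts G" if "z \<in> nbrs G x" for z
    using that assms by (auto simp: nbrs_def simple_graph_def)
  have "W (Suc n) x y = (\<Union>z\<in>nbrs G x. (#) x ` W n z y)"
  proof (rule set_eqI)
    fix w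
    show "w \<in> W (Suc n) x y \<longleftrightarrow> w \<in> (\<Union>z\<in>nbrs G x. (#) x ` W n z y)"
    proof (cases w)
      case (Cons a v)
      then show ?thesis by (cases v) (auto simp: W_def nbrs_def image_iff)
    qed (auto simp: W_def)
  qed
  moreover have "card (\<Union>z\<in>nbrs G x. (#) x ` W n z y) = (\<Sum>z\<in>nbrs G x. card ((#) x ` W n z y))"
    using Suc.IH sub fin by (intro card_UN_disjoint) (auto simp: W_def)
  moreover have "card ((#) x ` W n z y) = card (W n z y)" for z
    by (intro card_image) simp
  ultimately show ?case using Suc.IH sub fin by simp
qed

lemma card_closed_walks:
  assumes "simple_graph G" "locally_finite G" "x \<in> verts G"
  shows "real (card (closed_walks n G x)) = walk_weight (\<lambda>_. 1) G n x x"
  using card_walks[OF assms(1,2,3), of n x] by (simp add: closed_walks_def)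

text \<open>\<open>srw\<close> appends steps at the end, while \<open>walk_weight\<close> splits off
  the first; associativity of bind reconciles the two.\<close>

lemma srw_first_step: "srw G x (Suc n) = bind_pmf (srw_step G x) (\<lambda>z. srw G z n)"
proof (induction n)
  case (Suc n)
  have "srw G x (Suc (Suc n)) = bind_pmf (srw G x (Suc n)) (srw_step G)" by simp
  also have "\<dots> = bind_pmf (srw_step G x) (\<lambda>z. bind_pmf (srw G z n) (srw_step G))"
    by (simp only: Suc bind_assoc_pmf)
  finally show ?case by simp
qed (simp add: bind_return_pmf bind_return_pmf')

lemma pmf_srw:
  assumes "simple_graph G" "locally_finite G" "\<And>v. v \<in> verts G \<Longrightarrow> 0 < deg G v" "x \<in> verts G"
  shows "pmf (srw G x n) y = walk_weight (\<lambda>d. 1 / real d) G n x y"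
  using assms(4)
proof (induction n arbitrary: x)
  case (Suc n)
  have fin: "finite (nbrs G x)" "nbrs G x \<noteq> {}"
    using assms(2) assms(3)[OF Suc.prems] Suc.prems by (auto simp: locally_finite_def deg_def)
  have sub: "z \<in> verts G" if "z \<in> nbrs G x" for z
    using that assms(1) by (auto simp: nbrs_def simple_graph_def)
  have "pmf (srw G x (Suc n)) y = (\<Sum>z\<in>nbrs G x. pmf (srw G z n) y) / card (nbrs G x)"
    unfolding srw_first_step srw_step_def pmf_bind using fin by (simp add: integral_pmf_of_set)
  then show ?case using Suc.IH sub by (simp add: deg_def)
qed simp

text \<open>Allows the weights \<open>1 / deg\<close>, too small for \<open>weighted_graph\<close>,
  to be replaced by \<open>\<Delta> / deg\<close>.\<close>

lemma walk_weight_scale: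
  "walk_weight (\<lambda>d. c * u d) G n x y = c ^ n * walk_weight u G n x y"
  by (induction n arbitrary: x) (simp_all add: sum_distrib_left mult_ac)

section \<open>Local functions and measurability\<close>

text \<open>Weaker than an isomorphism of balls: only vertices at distance less than
  \<open>r\<close> have their neighbours controlled, so edges inside the outermost sphere are free.
  In this form the condition passes to smaller balls around other roots.\<close>

definition local_iso :: "'v graph \<Rightarrow> 'w graph \<Rightarrow> ('v \<Rightarrow> 'w) \<Rightarrow> 'v set \<Rightarrow> nat \<Rightarrow> bool" where
  "local_iso G H f A r \<longleftrightarrow> inj_on f (near_set G A r) \<and>
     (\<forall>j<r. \<forall>v\<in>near_set G A j. nbrs H (f v) = f ` nbrs G v)"

text \<open>Functions determined by a ball of fixed radius around the root(s) are locally constant in the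
  local topology, hence measurable.\<close>

definition vertex_local :: "(nat graph \<Rightarrow> nat \<Rightarrow> 'c) \<Rightarrow> bool" where
  "vertex_local \<psi> \<longleftrightarrow> (\<exists>r. \<forall>G H f x. local_iso G H f {x} r \<longrightarrow> \<psi> G x = \<psi> H (f x))"

definition edge_local :: "(nat graph \<Rightarrow> nat \<Rightarrow> nat \<Rightarrow> 'c) \<Rightarrow> bool" where
  "edge_local \<phi> \<longleftrightarrow>
     (\<exists>r. \<forall>G H f x y. local_iso G H f {x, y} r \<longrightarrow> \<phi> G x y = \<phi> H (f x) (f y))"

lemma near_set_mono: "A \<subseteq> B \<Longrightarrow> r \<le> s \<Longrightarrow> near_set G A r \<subseteq> near_set G B s"
  unfolding near_set_def by (blast intro: order.trans)

lemma near_set_add: "B \<subseteq> near_set G A s \<Longrightarrow> near_set G B r \<subseteq> near_set G A (s + r)"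
proof
  fix y assume B: "B \<subseteq> near_set G A s" and "y \<in> near_set G B r"
  then obtain b n where b: "b \<in> B" "n \<le> r" "(b, y) \<in> edges G ^^ n" by (auto simp: near_set_def)
  then obtain a m where "a \<in> A" "m \<le> s" "(a, b) \<in> edges G ^^ m" using B by (auto simp: near_set_def)
  then have "a \<in> A \<and> m + n \<le> s + r \<and> (a, y) \<in> edges G ^^ (m + n)"
    using b by (auto simp: relpow_add)
  then show "y \<in> near_set G A (s + r)" unfolding near_set_def by blast
qed

lemma self_near: "A \<subseteq> near_set G A r"
  by (force simp: near_set_def)

lemma nbrs_near:
  assumes "v \<in> near_set G A r" shows "nbrs G v \<subseteq> near_set G A (Suc r)"
proof
  fix y assume "y \<in> nbrs G v"
  then have "(v, y) \<in> edges G ^^ 1" by (simp add: nbrs_def)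
  then have "y \<in> near_set G {v} 1" unfolding near_set_def by blast
  then show "y \<in> near_set G A (Suc r)" using near_set_add[of "{v}" G A r 1] assms by auto
qed

text \<open>Moving a root by distance \<open>s\<close> costs \<open>s\<close> in the radius; this is
  what makes quantities at a neighbour of the root local.\<close>

lemma local_iso_subset:
  assumes iso: "local_iso G H f A (s + r)" and B: "B \<subseteq> near_set G A s"
  shows "local_iso G H f B r"
  unfolding local_iso_def
proof (intro conjI allI impI ballI)
  show "inj_on f (near_set G B r)"
    using iso near_set_add[OF B] by (auto simp: local_iso_def intro: inj_on_subset)
  fix j v assume "j < r" "v \<in> near_set G B j"
  then have "s + j < s + r" "v \<in> near_set G A (s + j)"
    using near_set_add[OF B] by auto
  then show "nbrs H (f v) = f ` nbrs G v" using iso unfolding local_iso_def by blast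
qed

lemma local_iso_mono: "local_iso G H f A r \<Longrightarrow> B \<subseteq> A \<Longrightarrow> s \<le> r \<Longrightarrow> local_iso G H f B s"
  using local_iso_subset[of G H f A "r - s" s B] near_set_mono[of B A 0 "r - s" G] self_near[of B G 0]
  by simp

lemma local_iso_nbrs: "local_iso G H f A (Suc r) \<Longrightarrow> x \<in> A \<Longrightarrow> nbrs H (f x) = f ` nbrs G x"
  using self_near[of A G 0] unfolding local_iso_def by blast

lemma local_iso_inj: "local_iso G H f A (Suc r) \<Longrightarrow> x \<in> A \<Longrightarrow> inj_on f (A \<union> nbrs G x)"
  unfolding local_iso_def
  using self_near[of A G "Suc r"] nbrs_near[of x G A r] self_near[of A G r]
  by (auto elim!: inj_on_subset)

lemma edge_local_const: "edge_local (\<lambda>G x y. c)"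
  by (auto simp: edge_local_def)

lemma edge_local_comp2:
  assumes "edge_local \<phi>" "edge_local \<psi>"
  shows "edge_local (\<lambda>G x y. h (\<phi> G x y) (\<psi> G x y))"
proof -
  obtain r s where "\<And>G H f x y. local_iso G H f {x, y} r \<Longrightarrow> \<phi> G x y = \<phi> H (f x) (f y)"
    "\<And>G H f x y. local_iso G H f {x, y} s \<Longrightarrow> \<psi> G x y = \<psi> H (f x) (f y)"
    using assms unfolding edge_local_def by blast
  then show ?thesis
    unfolding edge_local_def
    by (intro exI[of _ "max r s"]) (metis local_iso_mono max.cobounded1 max.cobounded2 order.refl)
qed

lemma edge_local_comp: "edge_local \<phi> \<Longrightarrow> edge_local (\<lambda>G x y. h (\<phi> G x y))"
  using edge_local_comp2[of \<phi> \<phi> "\<lambda>a b. h a"] .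

lemma edge_local_sum:
  "finite I \<Longrightarrow> (\<And>i. i \<in> I \<Longrightarrow> edge_local (\<phi> i)) \<Longrightarrow> edge_local (\<lambda>G x y. \<Sum>i\<in>I. \<phi> i G x y)"
proof (induction I rule: finite_induct)
  case (insert i I)
  then show ?case using edge_local_comp2[of "\<phi> i" _ "(+)"] by simp
qed (simp add: edge_local_const)

lemma edge_local_vertex:
  assumes "vertex_local \<psi>"
  shows "edge_local (\<lambda>G x y. \<psi> G x)" "edge_local (\<lambda>G x y. \<psi> G y)"
proof -
  obtain r where r: "\<And>G H f x. local_iso G H f {x} r \<Longrightarrow> \<psi> G x = \<psi> H (f x)"
    using assms unfolding vertex_local_def by blast
  have "\<psi> G x = \<psi> H (f x)" if "local_iso G H f A r" "x \<in> A" for G H f A x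
    by (rule r) (use that in \<open>auto intro: local_iso_mono\<close>)
  then show "edge_local (\<lambda>G x y. \<psi> G x)" "edge_local (\<lambda>G x y. \<psi> G y)"
    unfolding edge_local_def by blast+
qed

lemma edge_local_sum_nbrs:
  assumes "edge_local \<phi>"
  shows "edge_local (\<lambda>G x y. \<Sum>z\<in>nbrs G y - {x}. \<phi> G y z)"
proof -
  obtain r where r: "\<And>G H f x y. local_iso G H f {x, y} r \<Longrightarrow> \<phi> G x y = \<phi> H (f x) (f y)"
    using assms unfolding edge_local_def by blast
  have "(\<Sum>z\<in>nbrs G y - {x}. \<phi> G y z) = (\<Sum>z\<in>nbrs H (f y) - {f x}. \<phi> H (f y) z)"
    if iso: "local_iso G H f {x, y} (Suc r)" for G H f x y
  proof -
    \<comment> \<open>Injectivity on \<open>x\<close> together with the neighbours of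
      \<open>y\<close> ensures that deleting \<open>f x\<close> deletes the image of
      \<open>x\<close> and nothing else.\<close>
    have inj: "inj_on f ({x, y} \<union> nbrs G y)" using local_iso_inj[OF iso, of y] by simp
    have "nbrs H (f y) - {f x} = f ` (nbrs G y - {x})"
      using local_iso_nbrs[OF iso, of y] inj_onD[OF inj] by auto
    moreover have "inj_on f (nbrs G y - {x})" using inj by (rule inj_on_subset) auto
    moreover have "\<phi> G y z = \<phi> H (f y) (f z)" if "z \<in> nbrs G y" for z
      by (rule r, rule local_iso_subset[of _ _ _ "{x, y}" 1])
         (use that iso nbrs_near[of y G "{x, y}" 0] self_near[of "{x, y}" G] in auto)
    ultimately show ?thesis by (simp add: sum.reindex)
  qed
  then show ?thesis unfolding edge_local_def by blast
qed

lemma vertex_local_sum_nbrs: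
  assumes "edge_local \<phi>"
  shows "vertex_local (\<lambda>G x. \<Sum>y\<in>nbrs G x. \<phi> G x y)"
proof -
  obtain r where r: "\<And>G H f x y. local_iso G H f {x, y} r \<Longrightarrow> \<phi> G x y = \<phi> H (f x) (f y)"
    using assms unfolding edge_local_def by blast
  have "(\<Sum>y\<in>nbrs G x. \<phi> G x y) = (\<Sum>y\<in>nbrs H (f x). \<phi> H (f x) y)"
    if iso: "local_iso G H f {x} (Suc r)" for G H f x
  proof -
    have "inj_on f (nbrs G x)"
      by (rule inj_on_subset[OF local_iso_inj[OF iso, of x]]) auto
    moreover have "\<phi> G x z = \<phi> H (f x) (f z)" if "z \<in> nbrs G x" for z
      by (rule r, rule local_iso_subset[of _ _ _ "{x}" 1])
         (use that iso nbrs_near[of x G "{x}" 0] self_near[of "{x}" G] in auto)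
    ultimately show ?thesis using local_iso_nbrs[OF iso, of x] by (simp add: sum.reindex)
  qed
  then show ?thesis unfolding vertex_local_def by blast
qed

lemma vertex_local_deg: "vertex_local deg"
proof -
  have "deg G x = deg H (f x)" if iso: "local_iso G H f {x} (Suc 0)" for G H f and x :: nat
    using local_iso_nbrs[OF iso, of x] local_iso_inj[OF iso, of x]
    by (simp add: deg_def card_image inj_on_Un)
  then show ?thesis unfolding vertex_local_def by blast
qed

lemma edge_local_adjacent: "edge_local (\<lambda>G x y. y \<in> nbrs G x)"
proof -
  have "y \<in> nbrs G x \<longleftrightarrow> f y \<in> nbrs H (f x)" if iso: "local_iso G H f {x, y} (Suc 0)" for G H f
    and x y :: nat
    using local_iso_nbrs[OF iso, of x] inj_onD[OF local_iso_inj[OF iso, of x]] by auto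
  then show ?thesis unfolding edge_local_def by blast
qed

lemma vertex_local_comp: "vertex_local \<psi> \<Longrightarrow> vertex_local (\<lambda>G x. h (\<psi> G x))"
  unfolding vertex_local_def by metis

lemma vertex_local_comp2:
  assumes "vertex_local \<phi>" "vertex_local \<psi>"
  shows "vertex_local (\<lambda>G x. h (\<phi> G x) (\<psi> G x))"
proof -
  obtain r s where "\<And>G H f x. local_iso G H f {x} r \<Longrightarrow> \<phi> G x = \<phi> H (f x)"
    "\<And>G H f x. local_iso G H f {x} s \<Longrightarrow> \<psi> G x = \<psi> H (f x)"
    using assms unfolding vertex_local_def by blast
  then show ?thesis
    unfolding vertex_local_def
    by (intro exI[of _ "max r s"]) (metis local_iso_mono max.cobounded1 max.cobounded2 order.refl)
qed

lemma edge_local_branch_weight: "edge_local (\<lambda>G x y. branch_weight u G k x y)"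
proof (induction k rule: less_induct)
  case (less k)
  show ?case
  proof (cases k)
    case (Suc n)
    have U: "edge_local (\<lambda>G x y. u (deg G y))"
      using vertex_local_comp[OF vertex_local_deg, of u] by (rule edge_local_vertex)
    \<comment> \<open>Everything independent of \<open>z\<close> is pulled out, so that the inner
      summand depends on the edge \<open>y z\<close> alone.\<close>
    have "edge_local (\<lambda>G x y. \<Sum>i\<le>n. u (deg G y) *
        (\<Sum>z\<in>nbrs G y - {x}. u (deg G z) * branch_weight u G i y z) * branch_weight u G (n - i) x y)"
      using less Suc
      by (intro edge_local_sum edge_local_comp2[where h = "(*)"] U edge_local_sum_nbrs) auto
    then show ?thesis
      unfolding Suc by (simp add: sum_distrib_left sum_distrib_right mult_ac)
  qed (simp add: edge_local_const)
qed

lemma vertex_local_walk_weight: "vertex_local (\<lambda>G x. walk_weight u G n x x)"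
proof -
  \<comment> \<open>\<open>v\<close> is the current position of the walk, reached in at most
    \<open>j\<close> steps and with \<open>k\<close> still to go. Since
    \<open>j + k \<le> n\<close>, the walk never leaves the ball of radius \<open>n\<close>.\<close>
  have *: "walk_weight u G k v x = walk_weight u H k (f v) (f x)"
    if "local_iso G H f {x} (Suc n)" "v \<in> near_set G {x} j" "j + k \<le> n" for G H f and x v :: nat and j k
    using that
  proof (induction k arbitrary: v j)
    case 0
    have "inj_on f (near_set G {x} (Suc n))" using 0 by (simp add: local_iso_def)
    moreover have "x \<in> near_set G {x} (Suc n)" "v \<in> near_set G {x} (Suc n)"
      using self_near 0 near_set_mono[of "{x}" "{x}" j "Suc n" G] by fastforce+
    ultimately have "f v = f x \<longleftrightarrow> v = x" by (meson inj_on_eq_iff)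
    then show ?case by auto
  next
    case (Suc k)
    have iso: "local_iso G H f {v} (Suc 0)"
      by (rule local_iso_subset[of _ _ _ "{x}" j]) (use Suc in \<open>auto intro: local_iso_mono\<close>)
    have inj: "inj_on f (nbrs G v)" by (rule inj_on_subset[OF local_iso_inj[OF iso, of v]]) auto
    have deg: "deg H (f v) = deg G v"
      using local_iso_nbrs[OF iso, of v] inj by (simp add: deg_def card_image)
    have "walk_weight u G k z x = walk_weight u H k (f z) (f x)" if "z \<in> nbrs G v" for z
      by (rule Suc.IH[of _ "Suc j"]) (use Suc.prems that nbrs_near[of v G "{x}" j] in auto)
    then show ?case
      using local_iso_nbrs[OF iso, of v] inj deg by (simp add: sum.reindex)
  qed
  show ?thesis
    unfolding vertex_local_def 
    by (intro exI[of _ "Suc n"] allI impI *[of _ _ _ _ _ 0 n]) (auto simp: near_set_def)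
qed

text \<open>A neighbour of a vertex at distance less than \<open>r\<close> is still in the ball of
  radius \<open>r\<close>, and \<open>f\<close> does not increase the distance to the roots. So the
  induced balls show all neighbours of such a vertex and of its image.\<close>

lemma nbhd_iso_local_iso:
  assumes iso: "graph_iso f (nbhd G A r) (nbhd H (f ` A) r)"
    and G: "simple_graph G" and H: "simple_graph H" and A: "A \<subseteq> verts G"
  shows "local_iso G H f A r"
proof -
  have near: "near_set G A j \<subseteq> verts G" for j
  proof
    fix y assume "y \<in> near_set G A j"
    then obtain a n where a: "a \<in> A" "(a, y) \<in> edges G ^^ n" by (auto simp: near_set_def)
    then show "y \<in> verts G" using A G by (cases n) (auto simp: simple_graph_def)
  qed
  have V: "verts (nbhd G A r) = near_set G A r" using near by (auto simp: nbhd_def)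
  note f = graph_isoD[OF iso, unfolded V]
  have step: "(f v, f w) \<in> edges H"
    if "v \<in> near_set G A r" "w \<in> near_set G A r" "(v, w) \<in> edges G" for v w
    using f(4)[OF that(1,2)] that by (simp add: nbhd_def)
  have fnear: "f v \<in> near_set H (f ` A) j" if "v \<in> near_set G A j" "j \<le> r" for v j
  proof -
    have "(f a, f v) \<in> edges H ^^ n" if "a \<in> A" "n \<le> r" "(a, v) \<in> edges G ^^ n" for a n v
      using that
    proof (induction n arbitrary: v)
      case (Suc n)
      then obtain w where w: "(a, w) \<in> edges G ^^ n" "(w, v) \<in> edges G" by auto
      have "w \<in> near_set G A r" "v \<in> near_set G A r"
        using Suc.prems w unfolding near_set_def by (blast dest: Suc_leD)+
      then show ?case using Suc w step by auto
    qed simp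
    with that show ?thesis unfolding near_set_def by (blast intro: order.trans)
  qed
  show ?thesis
    unfolding local_iso_def
  proof (intro conjI allI impI ballI)
    fix j v assume j: "j < r" and v: "v \<in> near_set G A j"
    have vr: "v \<in> near_set G A r" using v j near_set_mono[of A A j r G] by auto
    have sub: "nbrs G v \<subseteq> near_set G A r"
      using nbrs_near[OF v] j near_set_mono[of A A "Suc j" r G] by auto
    show "nbrs H (f v) = f ` nbrs G v"
    proof
      show "f ` nbrs G v \<subseteq> nbrs H (f v)"
        using sub step[OF vr] by (auto simp: nbrs_def)
      show "nbrs H (f v) \<subseteq> f ` nbrs G v"
      proof
        fix w assume w: "w \<in> nbrs H (f v)"
        have "w \<in> near_set H (f ` A) (Suc j)"
          using nbrs_near[OF fnear[OF v]] j w by auto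
        then have wn: "w \<in> near_set H (f ` A) r" "f v \<in> near_set H (f ` A) r"
          using j near_set_mono[of "f ` A" "f ` A" "Suc j" r H] fnear[OF vr] by auto
        then have "w \<in> verts (nbhd H (f ` A) r)"
          using w H by (auto simp: nbhd_def nbrs_def simple_graph_def)
        then obtain z where z: "z \<in> near_set G A r" "w = f z" using f(3) by blast
        have "(f v, f z) \<in> edges (nbhd H (f ` A) r)"
          using w wn z by (auto simp: nbhd_def nbrs_def)
        then have "(v, z) \<in> edges G" using f(4)[OF vr z(1)] by (simp add: nbhd_def)
        then show "w \<in> f ` nbrs G v" using z by (auto simp: nbrs_def)
      qed
    qed
  qed (rule f(2))
qed

section \<open>Measurability of local functions on isomorphism classes\<close>

lemma valid_rep_rooted: "valid_rooted (rep_rooted_graph X)"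
  using Quotient_rep_reflp[OF Quotient_rooted_graph, of X] by simp

lemma valid_rep_birooted: "valid_birooted (rep_birooted_graph X)"
  using Quotient_rep_reflp[OF Quotient_birooted_graph, of X] by simp

lemma borel_measurable_locally_constant:
  fixes F :: "'a :: topological_space \<Rightarrow> 'b :: topological_space"
  assumes "\<And>x. \<exists>U. open U \<and> x \<in> U \<and> (\<forall>y\<in>U. F y = F x)"
  shows "F \<in> borel_measurable borel"
proof (rule borel_measurable_continuous_onI)
  show "continuous_on UNIV F"
    unfolding continuous_on_open_vimage[OF open_UNIV]
  proof (intro allI impI)
    fix B :: "'b set"
    assume "open B"
    have "open (F -` B)"
      using assms by (subst open_subopen) (metis subsetI vimageE vimageI)
    then show "open (F -` B \<inter> UNIV)" by simp
  qed
qed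

lemma measurable_vertex_local:
  fixes \<psi> :: "nat graph \<Rightarrow> nat \<Rightarrow> 'c :: topological_space"
  assumes "vertex_local \<psi>"
  shows "(\<lambda>X. case rep_rooted_graph X of (G, x) \<Rightarrow> \<psi> G x) \<in> borel_measurable borel"
proof (rule borel_measurable_locally_constant)
  fix X
  obtain r where r: "\<And>G H f x. local_iso G H f {x} r \<Longrightarrow> \<psi> G x = \<psi> H (f x)"
    using assms unfolding vertex_local_def by blast
  have "(case rep_rooted_graph Y of (G, x) \<Rightarrow> \<psi> G x) = (case rep_rooted_graph X of (G, x) \<Rightarrow> \<psi> G x)"
    if ball: "same_ball r X Y" for Y
  proof -
    obtain G x H y where XY: "rep_rooted_graph X = (G, x)" "rep_rooted_graph Y = (H, y)"
      by (metis surj_pair)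
    obtain f where f: "graph_iso f (nbhd G {x} r) (nbhd H {y} r)" "f x = y"
      using ball by (auto simp: same_ball.rep_eq XY)
    have "local_iso G H f {x} r"
      using f valid_rep_rooted[of X] valid_rep_rooted[of Y]
      by (intro nbhd_iso_local_iso) (auto simp: XY)
    from r[OF this] show ?thesis using f XY by simp
  qed
  moreover have "open {Y. same_ball r X Y}"
    unfolding open_rooted_graph_def by (rule generate_topology.Basis) blast
  ultimately show "\<exists>U. open U \<and> X \<in> U \<and>
      (\<forall>Y\<in>U. (case rep_rooted_graph Y of (G, x) \<Rightarrow> \<psi> G x) =
        (case rep_rooted_graph X of (G, x) \<Rightarrow> \<psi> G x))"
    using same_ball_refl[of r X] by blast
qed

definition biroot_fun :: "(nat graph \<Rightarrow> nat \<Rightarrow> nat \<Rightarrow> 'c) \<Rightarrow> birooted_graph \<Rightarrow> 'c" where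
  "biroot_fun \<phi> X = (case rep_birooted_graph X of (G, x, y) \<Rightarrow> \<phi> G x y)"

lemma biball_iso_local:
  assumes "\<forall>G H f x y. local_iso G H f {x, y} r \<longrightarrow> \<phi> G x y = \<phi> H (f x) (f y)"
    and "biball_iso r (G, x, y) (H, x', y')"
    and "valid_birooted (G, x, y)" "valid_birooted (H, x', y')"
  shows "\<phi> G x y = \<phi> H x' y'"
proof -
  obtain f where f: "graph_iso f (nbhd G {x, y} r) (nbhd H {x', y'} r)" "f x = x'" "f y = y'"
    using assms(2) by auto
  have "local_iso G H f {x, y} r"
    using f assms(3,4) by (intro nbhd_iso_local_iso) auto
  then show ?thesis using assms(1) f by blast
qed

lemma measurable_biroot_fun:
  fixes \<phi> :: "nat graph \<Rightarrow> nat \<Rightarrow> nat \<Rightarrow> 'c :: topological_space"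
  assumes "edge_local \<phi>"
  shows "biroot_fun \<phi> \<in> borel_measurable borel"
proof (rule borel_measurable_locally_constant)
  fix X
  obtain r where r: "\<forall>G H f x y. local_iso G H f {x, y} r \<longrightarrow> \<phi> G x y = \<phi> H (f x) (f y)"
    using assms unfolding edge_local_def by blast
  have "biroot_fun \<phi> Y = biroot_fun \<phi> X" if "same_biball r X Y" for Y
    using biball_iso_local[OF r] that valid_rep_birooted[of X] valid_rep_birooted[of Y]
    by (cases "rep_birooted_graph X"; cases "rep_birooted_graph Y")
       (simp add: biroot_fun_def same_biball.rep_eq del: biball_iso.simps)
  moreover have "open {Y. same_biball r X Y}"
    unfolding open_birooted_graph_def by (rule generate_topology.Basis) blast
  ultimately show "\<exists>U. open U \<and> X \<in> U \<and> (\<forall>Y\<in>U. biroot_fun \<phi> Y = biroot_fun \<phi> X)"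
    using same_biball_refl[of r X] by blast
qed

text \<open>\<open>biroot_fun\<close> reads a chosen representative. Local functions are invariant
  under isomorphism, so in mass transport they can be evaluated on the given graph.\<close>

lemma biroot_fun_abs:
  assumes "edge_local \<phi>" and valid: "valid_birooted (G, x, y)"
  shows "biroot_fun \<phi> (abs_birooted_graph (G, x, y)) = \<phi> G x y"
proof -
  obtain r where r: "\<forall>G H f x y. local_iso G H f {x, y} r \<longrightarrow> \<phi> G x y = \<phi> H (f x) (f y)"
    using assms unfolding edge_local_def by blast
  obtain H x' y' where H: "rep_birooted_graph (abs_birooted_graph (G, x, y)) = (H, x', y')"
    by (metis surj_pair)
  have "birooted_iso (H, x', y') (G, x, y) \<and> valid_birooted (H, x', y')"
    using Quotient_rep_abs[OF Quotient_birooted_graph, of "(G, x, y)"] valid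
    by (simp add: H birooted_iso_refl del: birooted_iso.simps valid_birooted.simps)
  then have "\<phi> H x' y' = \<phi> G x y"
    using valid by (intro biball_iso_local[OF r] birooted_iso_imp_biball_iso)
      (simp_all del: birooted_iso.simps valid_birooted.simps)
  then show ?thesis by (simp add: biroot_fun_def H)
qed

section \<open>Mass transport along edges\<close>

locale weighted_network =
  fixes M :: "'a measure" and T :: "'a \<Rightarrow> rooted_graph" and u :: "nat \<Rightarrow> real"
  assumes unimodular: "unimodular_network M T"
    and weighted: "AE \<omega> in M. weighted_graph u (fst (rep_rooted_graph (T \<omega>)))"
    and deg_integrable: "integrable M (\<lambda>\<omega>. real (root_deg (T \<omega>)))"
begin

abbreviation "gr \<omega> \<equiv> fst (rep_rooted_graph (T \<omega>))"
abbreviation "rt \<omega> \<equiv> snd (rep_rooted_graph (T \<omega>))"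

definition vertex_mean :: "(nat graph \<Rightarrow> nat \<Rightarrow> ennreal) \<Rightarrow> ennreal" where
  "vertex_mean \<psi> = (\<integral>\<^sup>+ \<omega>. \<psi> (gr \<omega>) (rt \<omega>) \<partial>M)"

text \<open>The degree-biased mean, left unnormalised: constants are multiplied by
  \<open>mean_deg\<close>, which accounts for that factor in the later inequalities.\<close>

definition edge_mean :: "(nat graph \<Rightarrow> nat \<Rightarrow> nat \<Rightarrow> ennreal) \<Rightarrow> ennreal" where
  "edge_mean \<phi> = vertex_mean (\<lambda>G x. \<Sum>y\<in>nbrs G x. \<phi> G x y)"

lemma prob_space: "prob_space M"
  using unimodular by (simp add: unimodular_network_def)

lemma rt_in: "rt \<omega> \<in> verts (gr \<omega>)" "simple_graph (gr \<omega>)" "locally_finite (gr \<omega>)"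
  using valid_rep_rooted[of "T \<omega>"] by (auto simp: case_prod_unfold split: prod.splits
      elim: valid_rooted.elims)

lemma measurable_network:
  fixes \<psi> :: "nat graph \<Rightarrow> nat \<Rightarrow> 'c :: topological_space"
  assumes "vertex_local \<psi>"
  shows "(\<lambda>\<omega>. \<psi> (gr \<omega>) (rt \<omega>)) \<in> borel_measurable M"
proof -
  have "T \<in> measurable M borel" using unimodular by (simp add: unimodular_network_def)
  from measurable_compose[OF this measurable_vertex_local[OF assms]]
  show ?thesis by (simp add: case_prod_unfold)
qed

lemma vertex_mean_mono:
  assumes "\<And>G x. weighted_graph u G \<Longrightarrow> x \<in> verts G \<Longrightarrow> \<phi> G x \<le> \<psi> G x"
  shows "vertex_mean \<phi> \<le> vertex_mean \<psi>"
  unfolding vertex_mean_def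
  by (rule nn_integral_mono_AE, rule AE_mp[OF weighted]) (use rt_in assms in auto)

lemma vertex_mean_cong:
  assumes "\<And>G x. weighted_graph u G \<Longrightarrow> x \<in> verts G \<Longrightarrow> \<phi> G x = \<psi> G x"
  shows "vertex_mean \<phi> = vertex_mean \<psi>"
  by (rule antisym; rule vertex_mean_mono) (simp_all add: assms)

lemma edge_mean_mono:
  assumes "\<And>G x y. weighted_graph u G \<Longrightarrow> x \<in> verts G \<Longrightarrow> y \<in> nbrs G x \<Longrightarrow> \<phi> G x y \<le> \<psi> G x y"
  shows "edge_mean \<phi> \<le> edge_mean \<psi>"
  unfolding edge_mean_def by (intro vertex_mean_mono sum_mono assms)

lemma edge_mean_add:
  assumes "edge_local \<phi>" "edge_local \<psi>"
  shows "edge_mean (\<lambda>G x y. \<phi> G x y + \<psi> G x y) = edge_mean \<phi> + edge_mean \<psi>"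
  unfolding edge_mean_def vertex_mean_def sum.distrib
  using assms by (intro nn_integral_add measurable_network vertex_local_sum_nbrs)

lemma edge_mean_cmult:
  assumes "edge_local \<phi>"
  shows "edge_mean (\<lambda>G x y. c * \<phi> G x y) = c * edge_mean \<phi>"
  unfolding edge_mean_def vertex_mean_def sum_distrib_left[symmetric]
  using assms by (intro nn_integral_cmult measurable_network vertex_local_sum_nbrs)

lemma edge_mean_sum:
  assumes "finite I" "\<And>i. i \<in> I \<Longrightarrow> edge_local (\<phi> i)"
  shows "edge_mean (\<lambda>G x y. \<Sum>i\<in>I. \<phi> i G x y) = (\<Sum>i\<in>I. edge_mean (\<phi> i))"
  using assms
proof (induction I rule: finite_induct)
  case empty
  then show ?case by (simp add: edge_mean_def vertex_mean_def)
next
  case (insert i I)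
  then have "edge_mean (\<lambda>G x y. \<phi> i G x y + (\<Sum>i\<in>I. \<phi> i G x y)) =
      edge_mean (\<phi> i) + edge_mean (\<lambda>G x y. \<Sum>i\<in>I. \<phi> i G x y)"
    by (intro edge_mean_add edge_local_sum) auto
  with insert show ?case by simp
qed

lemma edge_mean_vertex:
  "edge_mean (\<lambda>G x y. \<psi> G x) = vertex_mean (\<lambda>G x. of_nat (deg G x) * \<psi> G x)"
  by (simp add: edge_mean_def deg_def)

lemma edge_mean_swap:
  assumes \<phi>: "edge_local \<phi>"
  shows "edge_mean \<phi> = edge_mean (\<lambda>G x y. \<phi> G y x)"
proof -
  \<comment> \<open>Mass transport sums over all vertices; cutting \<open>\<phi>\<close> off outside
    the edges reduces both sides to sums over the neighbours of the root.\<close>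
  define \<theta> where "\<theta> G x y = (if y \<in> nbrs G x then \<phi> G x y else 0)" for G x y
  have \<theta>: "edge_local \<theta>"
    unfolding \<theta>_def by (intro edge_local_comp2[where h = "\<lambda>b a. if b then a else 0"]
        edge_local_adjacent \<phi>)
  have fin: "finite (nbrs (gr \<omega>) (rt \<omega>))" for \<omega>
    using rt_in[of \<omega>] by (auto simp: locally_finite_def)
  have sub: "nbrs (gr \<omega>) (rt \<omega>) \<subseteq> verts (gr \<omega>)" for \<omega>
    using rt_in[of \<omega>] by (auto simp: nbrs_def simple_graph_def)
  have adj: "rt \<omega> \<in> nbrs (gr \<omega>) y \<longleftrightarrow> y \<in> nbrs (gr \<omega>) (rt \<omega>)" for \<omega> y
    using rt_in(2)[of \<omega>] by (auto simp: nbrs_def simple_graph_def dest: symD)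
  have valid: "valid_birooted (gr \<omega>, rt \<omega>, y)" "valid_birooted (gr \<omega>, y, rt \<omega>)"
    if "y \<in> verts (gr \<omega>)" for \<omega> y
    using valid_rep_rooted[of "T \<omega>"] that by (cases "rep_rooted_graph (T \<omega>)"; simp)+
  have "mass_out (biroot_fun \<theta>) (T \<omega>) = (\<integral>\<^sup>+ y. \<theta> (gr \<omega>) (rt \<omega>) y \<partial>count_space (verts (gr \<omega>)))" for \<omega>
    unfolding mass_out.rep_eq case_prod_unfold
    using valid by (intro nn_integral_cong) (simp add: biroot_fun_abs[OF \<theta>])
  also have "(\<integral>\<^sup>+ y. \<theta> (gr \<omega>) (rt \<omega>) y \<partial>count_space (verts (gr \<omega>))) =
      (\<Sum>y\<in>nbrs (gr \<omega>) (rt \<omega>). \<theta> (gr \<omega>) (rt \<omega>) y)" for \<omega>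
    using fin sub by (intro nn_integral_count_space') (auto simp: \<theta>_def)
  also have "(\<Sum>y\<in>nbrs (gr \<omega>) (rt \<omega>). \<theta> (gr \<omega>) (rt \<omega>) y) =
      (\<Sum>y\<in>nbrs (gr \<omega>) (rt \<omega>). \<phi> (gr \<omega>) (rt \<omega>) y)" for \<omega>
    by (simp add: \<theta>_def)
  finally have out: "mass_out (biroot_fun \<theta>) (T \<omega>) = (\<Sum>y\<in>nbrs (gr \<omega>) (rt \<omega>). \<phi> (gr \<omega>) (rt \<omega>) y)"
    for \<omega> .
  have "mass_in (biroot_fun \<theta>) (T \<omega>) = (\<integral>\<^sup>+ y. \<theta> (gr \<omega>) y (rt \<omega>) \<partial>count_space (verts (gr \<omega>)))" for \<omega>
    unfolding mass_in.rep_eq case_prod_unfold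
    using valid by (intro nn_integral_cong) (simp add: biroot_fun_abs[OF \<theta>])
  also have "(\<integral>\<^sup>+ y. \<theta> (gr \<omega>) y (rt \<omega>) \<partial>count_space (verts (gr \<omega>))) =
      (\<Sum>y\<in>nbrs (gr \<omega>) (rt \<omega>). \<theta> (gr \<omega>) y (rt \<omega>))" for \<omega>
    using fin sub by (intro nn_integral_count_space') (auto simp: \<theta>_def adj)
  also have "(\<Sum>y\<in>nbrs (gr \<omega>) (rt \<omega>). \<theta> (gr \<omega>) y (rt \<omega>)) =
      (\<Sum>y\<in>nbrs (gr \<omega>) (rt \<omega>). \<phi> (gr \<omega>) y (rt \<omega>))" for \<omega>
    by (simp add: \<theta>_def adj)
  finally have "in": "mass_in (biroot_fun \<theta>) (T \<omega>) = (\<Sum>y\<in>nbrs (gr \<omega>) (rt \<omega>). \<phi> (gr \<omega>) y (rt \<omega>))"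
    for \<omega> .
  have "(\<integral>\<^sup>+ \<omega>. mass_out (biroot_fun \<theta>) (T \<omega>) \<partial>M) = (\<integral>\<^sup>+ \<omega>. mass_in (biroot_fun \<theta>) (T \<omega>) \<partial>M)"
    using unimodular measurable_biroot_fun[OF \<theta>] by (simp add: unimodular_network_def)
  then show ?thesis by (simp add: out "in" edge_mean_def vertex_mean_def)
qed

text \<open>The transition operator of the non-backtracking walk on directed edges, from
  \<open>x y\<close> to a uniform \<open>y z\<close> with \<open>z\<close> different from
  \<open>x\<close>.\<close>

definition nb_average :: "(nat graph \<Rightarrow> nat \<Rightarrow> nat \<Rightarrow> ennreal) \<Rightarrow> nat graph \<Rightarrow> nat \<Rightarrow> nat \<Rightarrow> ennreal" where
  "nb_average \<phi> G x y = ennreal (1 / (real (deg G y) - 1)) * (\<Sum>z\<in>nbrs G y - {x}. \<phi> G y z)"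

lemma edge_local_deg: "edge_local (\<lambda>G x y. h (deg G x))" "edge_local (\<lambda>G x y. h (deg G y))"
  using edge_local_vertex[OF vertex_local_comp[OF vertex_local_deg, of h]] .

lemma edge_local_nb_average: "edge_local \<phi> \<Longrightarrow> edge_local (nb_average \<phi>)"
  unfolding nb_average_def
  by (intro edge_local_comp2[where h = "(*)"] edge_local_deg edge_local_sum_nbrs)

text \<open>After a swap the sum at the root \<open>x\<close> is over ordered pairs of distinct
  neighbours \<open>y\<close>, \<open>z\<close>. Each \<open>z\<close> occurs with
  \<open>deg G x - 1\<close> choices of \<open>y\<close>, which cancels the normalisation.\<close>

lemma edge_mean_nb_average:
  assumes \<phi>: "edge_local \<phi>"
  shows "edge_mean (nb_average \<phi>) = edge_mean \<phi>"
proof -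
  have "edge_mean (nb_average \<phi>) = edge_mean (\<lambda>G x y. nb_average \<phi> G y x)"
    using \<phi> by (intro edge_mean_swap edge_local_nb_average)
  also have "\<dots> = edge_mean \<phi>"
    unfolding edge_mean_def
  proof (rule vertex_mean_cong)
    fix G :: "nat graph" and x assume "weighted_graph u G" and x: "x \<in> verts G"
    then interpret weighted_graph u G by simp
    let ?N = "nbrs G x" and ?c = "1 / (real (deg G x) - 1)"
    have d: "2 \<le> deg G x" using deg2[OF x] .
    have "(\<Sum>y\<in>?N. \<Sum>z\<in>?N - {y}. \<phi> G x z) = (\<Sum>z\<in>?N. \<Sum>y\<in>{y\<in>?N. z \<noteq> y}. \<phi> G x z)"
      by (subst sum.swap_restrict[OF finite_nbrs finite_nbrs, symmetric])
         (auto intro!: sum.cong)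
    also have "\<dots> = (\<Sum>z\<in>?N. of_nat (deg G x - 1) * \<phi> G x z)"
    proof (rule sum.cong[OF refl])
      fix z assume "z \<in> ?N"
      moreover have "{y\<in>?N. z \<noteq> y} = ?N - {z}" by auto
      ultimately show "(\<Sum>y\<in>{y\<in>?N. z \<noteq> y}. \<phi> G x z) = of_nat (deg G x - 1) * \<phi> G x z"
        by (simp add: deg_def finite_nbrs)
    qed
    finally have "(\<Sum>y\<in>?N. nb_average \<phi> G y x) =
        (ennreal ?c * of_nat (deg G x - 1)) * (\<Sum>z\<in>?N. \<phi> G x z)"
      by (simp add: nb_average_def mult.assoc flip: sum_distrib_left)
    moreover have "ennreal ?c * of_nat (deg G x - 1) = 1"
      using d unfolding ennreal_of_nat_eq_real_of_nat
      by (subst ennreal_mult[symmetric]) (auto simp: of_nat_diff)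
    ultimately show "(\<Sum>y\<in>?N. nb_average \<phi> G y x) = (\<Sum>z\<in>?N. \<phi> G x z)" by simp
  qed
  finally show ?thesis .
qed

section \<open>Induction on the biased mean of the logarithmic branch weights\<close>

definition mean_deg :: real where
  "mean_deg = (\<integral>\<omega>. real (root_deg (T \<omega>)) \<partial>M)"

definition log_growth :: ennreal where
  "log_growth = vertex_mean (\<lambda>G x. of_nat (deg G x) *
     ennreal (ln (real (deg G x) - 1) + 2 * ln (u (deg G x))))"

definition moment :: "nat \<Rightarrow> ennreal" where
  "moment k = vertex_mean (\<lambda>G x. ennreal (walk_weight u G (2 * k) x x))"

lemma root_deg_eq: "root_deg (T \<omega>) = deg (gr \<omega>) (rt \<omega>)"
  by (simp add: root_deg.rep_eq case_prod_unfold)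

lemma mean_deg: "vertex_mean (\<lambda>G x. of_nat (deg G x)) = ennreal mean_deg" "2 \<le> mean_deg"
proof -
  interpret prob_space M by (rule prob_space)
  show *: "vertex_mean (\<lambda>G x. of_nat (deg G x)) = ennreal mean_deg"
    unfolding vertex_mean_def mean_deg_def
    using nn_integral_eq_integral[OF deg_integrable]
    by (simp add: root_deg_eq ennreal_of_nat_eq_real_of_nat)
  have "vertex_mean (\<lambda>G x. 2) \<le> vertex_mean (\<lambda>G x. of_nat (deg G x))"
  proof (rule vertex_mean_mono)
    fix G :: "nat graph" and x assume "weighted_graph u G" "x \<in> verts G"
    from weighted_graph.deg2[OF this]
    show "2 \<le> (of_nat (deg G x) :: ennreal)"
      using of_nat_mono[of 2 "deg G x", where 'a = ennreal] by simp
  qed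
  then have "2 \<le> ennreal mean_deg"
    unfolding * by (simp add: vertex_mean_def emeasure_space_1)
  then show "2 \<le> mean_deg"
    by (metis ennreal_le_iff2 ennreal_numeral not_numeral_le_zero order.trans zero_le_numeral)
qed

abbreviation "ln_branch k \<equiv> (\<lambda>G x y. ennreal (ln (branch_weight u G k x y)))"

lemma ln_branch_Suc:
  assumes "weighted_graph u G" and y: "y \<in> nbrs G x"
  shows "(ennreal (ln (u (deg G y)) + ln (real (deg G y) - 1)) +
      nb_average (\<lambda>G x y. ennreal (ln (u (deg G y)))) G x y) +
      (\<Sum>i\<le>k. ennreal (catalan_split k i) * (nb_average (ln_branch i) G x y +
        ln_branch (k - i) G x y + ennreal (- ln (catalan_split k i)))) \<le> ln_branch (Suc k) G x y"
proof -
  interpret weighted_graph u G by fact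
  have x: "x \<in> nbrs G y" and yV: "y \<in> verts G" using y nbrs_sym nbrs_verts by blast+
  let ?N = "nbrs G y - {x}" and ?m = "real (deg G y) - 1" and ?w = "catalan_split k"
  have NV: "z \<in> verts G" if "z \<in> ?N" for z using that nbrs_verts by auto
  have m: "1 \<le> ?m" using deg2[OF yV] by simp
  have w: "0 \<le> ?w i" "i \<le> k \<Longrightarrow> 0 \<le> - ln (?w i)" for i
    using catalan_split(2)[of k i] catalan_split(3)[of i k] by (auto intro: less_imp_le)
  have lnF: "0 \<le> ln (F i a b)" if "b \<in> verts G" for i a b using F_ge_1[OF that] by simp
  have lnU: "0 \<le> ln (U b)" if "b \<in> verts G" for b using u1[OF that] by simp
  have av0: "0 \<le> (\<Sum>z\<in>?N. f z) / ?m" if "\<And>z. z \<in> ?N \<Longrightarrow> 0 \<le> f z" for f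
    using that m by (intro divide_nonneg_nonneg sum_nonneg) auto
  have av: "ennreal (1 / ?m) * (\<Sum>z\<in>?N. ennreal (f z)) = ennreal ((\<Sum>z\<in>?N. f z) / ?m)"
    if f: "\<And>z. z \<in> ?N \<Longrightarrow> 0 \<le> f z" for f
  proof -
    have "(\<Sum>z\<in>?N. ennreal (f z)) = ennreal (\<Sum>z\<in>?N. f z)" "0 \<le> (\<Sum>z\<in>?N. f z)"
      using f by (intro sum_ennreal sum_nonneg; blast)+
    then show ?thesis using m by (simp add: ennreal_mult[symmetric])
  qed
  let ?t = "\<lambda>i. (\<Sum>z\<in>?N. ln (F i y z)) / ?m + ln (F (k - i) x y) + (- ln (?w i))"
  have t0: "0 \<le> ?t i" if "i \<le> k" for i
    using that w(2)[OF that] lnF[OF yV, of "k - i" x] av0[of "\<lambda>z. ln (F i y z)"] lnF NV by auto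
  have "ennreal (?w i) * (nb_average (ln_branch i) G x y +
        ln_branch (k - i) G x y + ennreal (- ln (?w i))) = ennreal (?w i * ?t i)" if i: "i \<le> k" for i
    unfolding nb_average_def
    using av[of "\<lambda>z. ln (F i y z)"] av0[of "\<lambda>z. ln (F i y z)"] lnF NV w(1) w(2)[OF i] lnF[OF yV] t0[OF i]
    by (simp add: ennreal_plus[symmetric] ennreal_mult[symmetric] del: ennreal_plus)
  then have "(\<Sum>i\<le>k. ennreal (?w i) * (nb_average (ln_branch i) G x y +
        ln_branch (k - i) G x y + ennreal (- ln (?w i)))) = (\<Sum>i\<le>k. ennreal (?w i * ?t i))"
    by (intro sum.cong) auto
  also have "\<dots> = ennreal (\<Sum>i\<le>k. ?w i * ?t i)"
    using t0 w(1) by (intro sum_ennreal mult_nonneg_nonneg) auto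
  finally have "(\<Sum>i\<le>k. ennreal (?w i) * (nb_average (ln_branch i) G x y +
        ln_branch (k - i) G x y + ennreal (- ln (?w i)))) = ennreal (\<Sum>i\<le>k. ?w i * ?t i)" .
  moreover have "nb_average (\<lambda>G x y. ennreal (ln (u (deg G y)))) G x y =
      ennreal ((\<Sum>z\<in>?N. ln (U z)) / ?m)"
    unfolding nb_average_def using lnU NV by (intro av) auto
  moreover have "0 \<le> (\<Sum>z\<in>?N. ln (U z)) / ?m" "0 \<le> (\<Sum>i\<le>k. ?w i * ?t i)" "0 \<le> ln (U y) + ln ?m"
    using av0[of "\<lambda>z. ln (U z)"] lnU NV t0 w(1) lnU[OF yV] m
    by (auto intro!: sum_nonneg mult_nonneg_nonneg add_nonneg_nonneg)
  ultimately show ?thesis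
    using ln_branch_Suc_ge[OF x, of k] by (simp add: ennreal_plus[symmetric] del: ennreal_plus)
qed

lemma edge_local_ln_branch: "edge_local (ln_branch k)"
  by (intro edge_local_comp[where h = "\<lambda>t. ennreal (ln t)"] edge_local_branch_weight)

lemma edge_mean_const: "edge_mean (\<lambda>G x y. c) = c * ennreal mean_deg"
proof -
  have "edge_mean (\<lambda>G x y. c * 1) = c * edge_mean (\<lambda>G x y. 1)"
    by (rule edge_mean_cmult[OF edge_local_const])
  then show ?thesis
    by (simp add: mean_deg(1)[symmetric] edge_mean_vertex[of "\<lambda>_ _. 1"])
qed

text \<open>Strong induction, valid also for infinite \<open>log_growth\<close>. In the step to
  \<open>Suc n\<close> the recursion contributes one copy of \<open>log_growth\<close>, and the
  factors of index \<open>i\<close> and \<open>n - i\<close> contribute the other \<open>n\<close>,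
  whatever \<open>i\<close> is.\<close>

lemma ln_branch_mean_ge:
  "ennreal (ln (catalan k)) * ennreal mean_deg + of_nat k * log_growth \<le> edge_mean (ln_branch k)"
proof (induction k rule: less_induct)
  case (less k)
  show ?case
  proof (cases k)
    case 0
    then show ?thesis by simp
  next
    case (Suc n)
    let ?w = "catalan_split n" and ?D = "ennreal mean_deg"
    let ?V = "\<lambda>G x y. ennreal (ln (u (deg G y)) + ln (real (deg G y) - 1))"
    let ?U = "\<lambda>G x y. ennreal (ln (u (deg G y)))"
    let ?t = "\<lambda>i G x y. ennreal (?w i) * (nb_average (ln_branch i) G x y +
        ln_branch (n - i) G x y + ennreal (- ln (?w i)))"
    have loc: "edge_local ?V" "edge_local ?U" "edge_local (nb_average ?U)"
      by (intro edge_local_deg edge_local_nb_average)+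
    have loc': "edge_local (\<lambda>G x y. nb_average (ln_branch i) G x y + ln_branch (n - i) G x y)" for i
      by (intro edge_local_comp2[where h = "(+)"] edge_local_nb_average edge_local_ln_branch)
    have loc'': "edge_local (\<lambda>G x y. nb_average (ln_branch i) G x y + ln_branch (n - i) G x y +
        ennreal (- ln (?w i)))" for i
      by (intro edge_local_comp2[where h = "(+)"] loc' edge_local_const)
    have loct: "edge_local (?t i)" for i
      by (intro edge_local_comp2[where h = "(*)"] loc'' edge_local_const)
    \<comment> \<open>The degree in the definition is that at the start of the edge; a swap moves it
      to the end \<open>y\<close>. Of the two terms \<open>ln u\<close>, one stays at
      \<open>y\<close> and the other passes to the child by stationarity of the non-backtracking
      step.\<close>
    have "log_growth = edge_mean (\<lambda>G x y. ennreal (ln (real (deg G x) - 1) + 2 * ln (u (deg G x))))"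
      by (simp add: log_growth_def edge_mean_vertex)
    also have "\<dots> = edge_mean (\<lambda>G x y. ennreal (ln (real (deg G y) - 1) + 2 * ln (u (deg G y))))"
      by (intro edge_mean_swap edge_local_deg)
    also have "\<dots> \<le> edge_mean (\<lambda>G x y. ?V G x y + ?U G x y)"
    proof (rule edge_mean_mono)
      fix G :: "nat graph" and x y assume "weighted_graph u G" "y \<in> nbrs G x"
      then interpret weighted_graph u G by simp
      have "y \<in> verts G" using \<open>y \<in> nbrs G x\<close> nbrs_verts by blast
      then show "ennreal (ln (real (deg G y) - 1) + 2 * ln (u (deg G y))) \<le> ?V G x y + ?U G x y"
        using u1[of y] deg2[of y]
        by (subst ennreal_plus[symmetric]) (auto intro!: ennreal_leI add_nonneg_nonneg)
    qed
    also have "\<dots> = edge_mean ?V + edge_mean ?U"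
      by (rule edge_mean_add[OF loc(1,2)])
    finally have ent: "log_growth \<le> edge_mean ?V + edge_mean (nb_average ?U)"
      using edge_mean_nb_average[OF loc(2)] by simp
    have step: "ennreal (?w i) * (ennreal (ln (catalan (Suc n))) * ?D + of_nat n * log_growth) \<le>
        edge_mean (?t i)" if i: "i \<le> n" for i
    proof -
      have c: "0 \<le> ln (catalan j)" for j using catalan_ge_1[of j] by simp
      have w: "0 \<le> - ln (?w i)" using catalan_split(2)[of n i] catalan_split(3)[of i n] i by simp
      have "edge_mean (?t i) = ennreal (?w i) * (edge_mean (nb_average (ln_branch i)) +
          edge_mean (ln_branch (n - i)) + ennreal (- ln (?w i)) * ?D)"
        using edge_mean_cmult[OF loc''] edge_mean_add[OF loc' edge_local_const]
          edge_mean_add[OF edge_local_nb_average[OF edge_local_ln_branch] edge_local_ln_branch]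
        by (simp add: edge_mean_const)
      also have "edge_mean (nb_average (ln_branch i)) = edge_mean (ln_branch i)"
        by (rule edge_mean_nb_average[OF edge_local_ln_branch])
      finally have eq: "edge_mean (?t i) = ennreal (?w i) * (edge_mean (ln_branch i) +
          edge_mean (ln_branch (n - i)) + ennreal (- ln (?w i)) * ?D)" .
      have "ln (catalan (Suc n)) = ln (catalan i) + ln (catalan (n - i)) + (- ln (?w i))"
        using catalan_split(4)[of i n] by linarith
      then have "ennreal (ln (catalan (Suc n))) * ?D + of_nat n * log_growth =
          (ennreal (ln (catalan i)) + ennreal (ln (catalan (n - i))) + ennreal (- ln (?w i))) * ?D
           + (of_nat i + of_nat (n - i)) * log_growth"
        using c w i by (simp add: ennreal_plus[symmetric] of_nat_add[symmetric]
            del: ennreal_plus of_nat_add catalan.simps)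
      also have "\<dots> = (ennreal (ln (catalan i)) * ?D + of_nat i * log_growth) +
          (ennreal (ln (catalan (n - i))) * ?D + of_nat (n - i) * log_growth) + ennreal (- ln (?w i)) * ?D"
        by (simp only: distrib_right add_ac)
      also have "\<dots> \<le> edge_mean (ln_branch i) +
          edge_mean (ln_branch (n - i)) + ennreal (- ln (?w i)) * ?D"
        using i Suc by (intro add_mono less.IH order.refl) auto
      finally show ?thesis unfolding eq by (intro mult_left_mono) auto
    qed
    have "(\<Sum>i\<le>n. ennreal (?w i)) = 1"
      using catalan_split(1)[of n] less_imp_le[OF catalan_split(2)[of n]] by (simp add: sum_ennreal)
    then have "ennreal (ln (catalan k)) * ?D + of_nat k * log_growth =
       log_growth + (\<Sum>i\<le>n. ennreal (?w i)) * (ennreal (ln (catalan (Suc n))) * ?D + of_nat n * log_growth)"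
      by (simp add: Suc distrib_right add_ac del: catalan.simps)
    also have "\<dots> \<le> (edge_mean ?V + edge_mean (nb_average ?U)) + (\<Sum>i\<le>n. edge_mean (?t i))"
      unfolding sum_distrib_right using ent step by (intro add_mono sum_mono) auto
    also have "\<dots> = edge_mean (\<lambda>G x y. (?V G x y + nb_average ?U G x y) + (\<Sum>i\<le>n. ?t i G x y))"
      using edge_mean_add[OF loc(1,3)] edge_mean_sum[of "{..n}" ?t] loct
        edge_mean_add[OF edge_local_comp2[OF loc(1,3), of "(+)"] edge_local_sum[of "{..n}" ?t]]
      by simp
    also have "\<dots> \<le> edge_mean (ln_branch k)"
      unfolding Suc by (rule edge_mean_mono) (rule ln_branch_Suc)
    finally show ?thesis .
  qed
qed

end

section \<open>Moments and their growth\<close>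

text \<open>From \<open>a 0 = 1\<close> and log-convexity,
  \<open>a k ^ Suc k \<le> a (Suc k) ^ k\<close> follows by induction; it is the claim raised to the
  power \<open>2 * k * Suc k\<close>. At \<open>k = 0\<close> the root is 0 by convention.\<close>

lemma incseq_root_log_convex:
  fixes a :: "nat \<Rightarrow> real"
  assumes "a 0 = 1" and ge1: "\<And>k. 1 \<le> a k"
    and convex: "\<And>k. (a (Suc k))\<^sup>2 \<le> a k * a (Suc (Suc k))"
  shows "incseq (\<lambda>k. root (2 * k) (a k))"
proof (rule incseq_SucI)
  fix k
  have pos: "0 < a j" for j using ge1[of j] by linarith
  have *: "a k ^ Suc k \<le> a (Suc k) ^ k" for k
  proof (induction k)
    case (Suc k)
    have "a (Suc k) ^ k * a (Suc k) ^ Suc (Suc k) = ((a (Suc k))\<^sup>2) ^ Suc k"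
      by (simp only: power_mult[symmetric] power_add[symmetric]) (simp add: mult_2 del: power_Suc)
    also have "\<dots> \<le> (a k * a (Suc (Suc k))) ^ Suc k"
      using convex by (intro power_mono) auto
    also have "\<dots> = a k ^ Suc k * a (Suc (Suc k)) ^ Suc k"
      by (rule power_mult_distrib)
    also have "\<dots> \<le> a (Suc k) ^ k * a (Suc (Suc k)) ^ Suc k"
      using Suc less_imp_le[OF pos] by (intro mult_right_mono) auto
    finally show ?case using pos[of "Suc k"] by simp
  qed (simp add: assms(1))
  show "root (2 * k) (a k) \<le> root (2 * Suc k) (a (Suc k))"
  proof (cases "k = 0")
    case False
    show ?thesis
    proof (rule power_le_imp_le_base)
      have "root (2 * k) (a k) ^ (2 * k * Suc k) = a k ^ Suc k"
        unfolding power_mult[of _ "2 * k"] using False pos[of k]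
        by (subst real_root_pow_pos2) auto
      also have "\<dots> \<le> a (Suc k) ^ k" by (rule *)
      also have "a (Suc k) ^ k = root (2 * Suc k) (a (Suc k)) ^ (2 * Suc k * k)"
        unfolding power_mult[of _ "2 * Suc k"] using pos[of "Suc k"]
        by (subst real_root_pow_pos2) auto
      finally show "root (2 * k) (a k) ^ Suc (2 * k * Suc k - 1) \<le>
          root (2 * Suc k) (a (Suc k)) ^ Suc (2 * k * Suc k - 1)"
        using False by (simp add: mult_ac)
    qed (use pos[of "Suc k"] in simp)
  qed (use pos[of 1] in simp)
qed

text \<open>Comparing powers bounds \<open>catalan k\<close> by a constant times
  \<open>(r\<^sup>2 / q) ^ k\<close>, so this ratio is at least 4. The index shift in
  \<open>a (Suc k)\<close> only affects the constant.\<close>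

lemma growth_rate_ge:
  fixes a :: "nat \<Rightarrow> real"
  assumes lower: "\<And>k. D * catalan k * q ^ k \<le> a (Suc k)"
    and upper: "\<And>k. root (2 * Suc k) (a (Suc k)) \<le> r"
    and "0 < D" "0 < q" and a: "\<And>k. 1 \<le> a k"
  shows "2 * sqrt q \<le> r"
proof -
  have r: "0 \<le> r" using order.trans[OF _ upper[of 0]] a[of 1] by simp
  have "catalan k \<le> r\<^sup>2 / D * (r\<^sup>2 / q) ^ k" for k
  proof -
    have "a (Suc k) = root (2 * Suc k) (a (Suc k)) ^ (2 * Suc k)"
      using a[of "Suc k"] by (intro real_root_pow_pos2[symmetric]) auto
    also have "\<dots> \<le> r ^ (2 * Suc k)"
      using upper a[of "Suc k"] by (intro power_mono) auto
    also have "\<dots> = r\<^sup>2 * (r\<^sup>2) ^ k" by (simp only: power_mult power_Suc)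
    finally have "D * catalan k * q ^ k \<le> r\<^sup>2 * (r\<^sup>2) ^ k" using lower[of k] by linarith
    then show ?thesis using \<open>0 < D\<close> \<open>0 < q\<close> by (simp add: power_divide field_simps)
  qed
  then have "4 \<le> r\<^sup>2 / q" by (rule catalan_growth) (use \<open>0 < q\<close> in simp)
  then have "(2 * sqrt q)\<^sup>2 \<le> r\<^sup>2" using \<open>0 < q\<close> by (simp add: field_simps power_mult_distrib)
  then show ?thesis using r by (rule power2_le_imp_le)
qed

section \<open>Lower bounds for the moments and their roots\<close>

context weighted_network
begin

lemma moment_0: "moment 0 = 1"
proof -
  interpret prob_space M by (rule prob_space)
  show ?thesis by (simp add: moment_def vertex_mean_def emeasure_space_1)
qed

lemma vertex_local_K: "vertex_local (\<lambda>G x. h (walk_weight u G n x x))"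
  by (rule vertex_local_comp[OF vertex_local_walk_weight])

text \<open>Log-convexity holds at each root, and Cauchy-Schwarz for the square roots of the walk
  weights carries it over to expectations, infinite ones included.\<close>

lemma moment_log_convex: "(moment (Suc k))\<^sup>2 \<le> moment k * moment (Suc (Suc k))"
proof -
  let ?f = "\<lambda>n \<omega>. ennreal (sqrt (walk_weight u (gr \<omega>) (2 * n) (rt \<omega>) (rt \<omega>)))"
  have [measurable]: "?f n \<in> borel_measurable M" for n
    by (rule measurable_network[OF vertex_local_K[where h = "\<lambda>t. ennreal (sqrt t)"]])
  have sq: "(\<integral>\<^sup>+ \<omega>. (?f n \<omega>)\<^sup>2 \<partial>M) = moment n" for n
    unfolding moment_def vertex_mean_def
  proof (rule nn_integral_cong_AE, rule AE_mp[OF weighted], intro AE_I2 impI)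
    fix \<omega> assume "weighted_graph u (gr \<omega>)"
    from weighted_graph.K_nonneg[OF this rt_in(1), of "2 * n" "rt \<omega>"]
    show "(?f n \<omega>)\<^sup>2 = ennreal (walk_weight u (gr \<omega>) (2 * n) (rt \<omega>) (rt \<omega>))"
      by (simp add: ennreal_power)
  qed
  have "moment (Suc k) \<le> (\<integral>\<^sup>+ \<omega>. ?f k \<omega> * ?f (Suc (Suc k)) \<omega> \<partial>M)"
    unfolding moment_def vertex_mean_def
  proof (rule nn_integral_mono_AE, rule AE_mp[OF weighted], intro AE_I2 impI)
    fix \<omega> assume w: "weighted_graph u (gr \<omega>)"
    note K0 = weighted_graph.K_nonneg[OF w rt_in(1), of _ "rt \<omega>"]
    from weighted_graph.K_log_convex[OF w rt_in(1), of k "Suc (Suc k)"]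
    have "walk_weight u (gr \<omega>) (2 * Suc k) (rt \<omega>) (rt \<omega>) \<le>
        sqrt (walk_weight u (gr \<omega>) (2 * k) (rt \<omega>) (rt \<omega>) *
          walk_weight u (gr \<omega>) (2 * Suc (Suc k)) (rt \<omega>) (rt \<omega>))"
      by (intro real_le_rsqrt) (simp add: mult_2 del: walk_weight.simps)
    then show "ennreal (walk_weight u (gr \<omega>) (2 * Suc k) (rt \<omega>) (rt \<omega>)) \<le> ?f k \<omega> * ?f (Suc (Suc k)) \<omega>"
      using K0 by (subst ennreal_mult[symmetric])
        (auto intro!: ennreal_leI simp: real_sqrt_mult simp del: walk_weight.simps)
  qed
  then have "(moment (Suc k))\<^sup>2 \<le> (\<integral>\<^sup>+ \<omega>. ?f k \<omega> * ?f (Suc (Suc k)) \<omega> \<partial>M)\<^sup>2"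
    by (rule power_mono) simp
  also have "\<dots> \<le> (\<integral>\<^sup>+ \<omega>. (?f k \<omega>)\<^sup>2 \<partial>M) * (\<integral>\<^sup>+ \<omega>. (?f (Suc (Suc k)) \<omega>)\<^sup>2 \<partial>M)"
    by (rule Cauchy_Schwarz_nn_integral) measurable
  finally show ?thesis by (simp only: sq)
qed

lemma deg_walk_le_moment:
  "vertex_mean (\<lambda>G x. of_nat (deg G x) * ennreal (walk_weight u G (2 * k) x x)) \<le> moment (Suc k)"
  unfolding moment_def
proof (rule vertex_mean_mono)
  fix G :: "nat graph" and x assume "weighted_graph u G" and x: "x \<in> verts G"
  then interpret weighted_graph u G by simp
  show "of_nat (deg G x) * ennreal (K (2 * k) x x) \<le> ennreal (K (2 * Suc k) x x)"
    unfolding ennreal_of_nat_eq_real_of_nat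
    using deg_mult_K_le[OF x, of k] K_nonneg[OF x]
    by (subst ennreal_mult[symmetric]) (auto intro!: ennreal_leI simp del: walk_weight.simps)
qed

lemma mean_deg_le_moment: "ennreal mean_deg \<le> moment (Suc k)"
proof -
  have "ennreal mean_deg \<le>
      vertex_mean (\<lambda>G x. of_nat (deg G x) * ennreal (walk_weight u G (2 * k) x x))"
    unfolding mean_deg(1)[symmetric]
  proof (rule vertex_mean_mono)
    fix G :: "nat graph" and x assume *: "weighted_graph u G" "x \<in> verts G"
    then have "1 \<le> ennreal (walk_weight u G (2 * k) x x)"
      using weighted_graph.K_even_ge_1[OF *] by (simp del: walk_weight.simps)
    from mult_left_mono[OF this, of "of_nat (deg G x)"]
    show "of_nat (deg G x) \<le> of_nat (deg G x) * ennreal (walk_weight u G (2 * k) x x)" by simp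
  qed
  then show ?thesis using deg_walk_le_moment order.trans by blast
qed

lemma moment_mono: "moment k \<le> moment (Suc k)"
proof -
  have "moment k \<le> vertex_mean (\<lambda>G x. of_nat (deg G x) * ennreal (walk_weight u G (2 * k) x x))"
    unfolding moment_def
  proof (rule vertex_mean_mono)
    fix G :: "nat graph" and x assume *: "weighted_graph u G" "x \<in> verts G"
    then have "1 \<le> (of_nat (deg G x) :: ennreal)"
      using weighted_graph.deg2[OF *] of_nat_mono[of 1 "deg G x", where 'a = ennreal] by simp
    from mult_right_mono[OF this]
    show "ennreal (walk_weight u G (2 * k) x x) \<le>
        of_nat (deg G x) * ennreal (walk_weight u G (2 * k) x x)" by fastforce
  qed
  then show ?thesis using deg_walk_le_moment order.trans by blast
qed

lemma moment_ge_1: "1 \<le> moment k"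
  by (induction k) (auto simp: moment_0 intro: order.trans[OF _ moment_mono])

lemma log_growth_le:
  assumes m: "moment (Suc k) = ennreal m"
  shows "ennreal (ln (catalan k)) * ennreal mean_deg + of_nat k * log_growth \<le>
    ennreal (mean_deg * ln (m / mean_deg))" "mean_deg \<le> m"
proof -
  let ?D = "mean_deg" and ?K = "\<lambda>G x. walk_weight u G (2 * k) x x"
  have D: "2 \<le> ?D" by (rule mean_deg(2))
  have "0 < m"
    using moment_ge_1[of "Suc k"] unfolding m by (metis ennreal_eq_0_iff not_le not_one_le_zero)
  then show Dm: "?D \<le> m"
    using mean_deg_le_moment[of k] m D by simp
  \<comment> \<open>An upper bound for the biased mean of the walk weight, and the point at which
    the tangent to \<open>ln\<close> is taken.\<close>
  define s where "s = m / ?D"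
  have s: "1 \<le> s" using Dm D by (simp add: s_def)
  let ?A = "vertex_mean (\<lambda>G x. of_nat (deg G x) * ennreal (ln (?K G x)))"
  let ?B = "vertex_mean (\<lambda>G x. of_nat (deg G x) * ennreal (?K G x))"
  have deg: "vertex_local (\<lambda>G x. of_nat (deg G x) :: ennreal)"
    by (rule vertex_local_comp[OF vertex_local_deg])
  have "ennreal (ln (catalan k)) * ennreal mean_deg + of_nat k * log_growth \<le> edge_mean (ln_branch k)"
    by (rule ln_branch_mean_ge)
  \<comment> \<open>The branch walks start at the far end of the edge; the swap puts that vertex at
    the root.\<close>
  also have "\<dots> = edge_mean (\<lambda>G x y. ln_branch k G y x)"
    by (rule edge_mean_swap[OF edge_local_ln_branch])
  also have "\<dots> \<le> edge_mean (\<lambda>G x y. ennreal (ln (?K G x)))"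
  proof (rule edge_mean_mono)
    fix G :: "nat graph" and x y assume "weighted_graph u G" and x: "x \<in> verts G"
    then interpret weighted_graph u G by simp
    show "ennreal (ln (F k y x)) \<le> ennreal (ln (?K G x))"
      using branch_le_walk[OF x, of k y] F_ge_1[OF x, of k y] K_even_ge_1[OF x, of k]
      by (intro ennreal_leI) simp
  qed
  also have "\<dots> = ?A" by (rule edge_mean_vertex)
  also have "?A \<le> ennreal (?D * ln s)"
  proof -
    \<comment> \<open>The tangent bound \<open>ln K \<le> ln s + K / s - 1\<close> is used with the
      1 moved to the left, to avoid subtraction in \<open>ennreal\<close>; \<open>ennreal ?D\<close>
      is the biased mean of that 1.\<close>
    have "?A + ennreal ?D = vertex_mean (\<lambda>G x. of_nat (deg G x) * ennreal (ln (?K G x)) + of_nat (deg G x))"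
      unfolding mean_deg(1)[symmetric] vertex_mean_def
      by (intro nn_integral_add[symmetric] measurable_network[OF deg]
          measurable_network[OF vertex_local_comp2[OF deg vertex_local_K, of "(*)"]])
    also have "\<dots> \<le> vertex_mean (\<lambda>G x. of_nat (deg G x) * ennreal (ln s) +
        ennreal (1 / s) * (of_nat (deg G x) * ennreal (?K G x)))"
    proof (rule vertex_mean_mono)
      fix G :: "nat graph" and x assume *: "weighted_graph u G" "x \<in> verts G"
      have K: "1 \<le> ?K G x" by (rule weighted_graph.K_even_ge_1[OF *])
      have "ln (?K G x) + 1 \<le> ln s + 1 / s * ?K G x"
        using ln_le_minus_one[of "?K G x / s"] K s by (simp add: ln_div)
      then have "ennreal (real (deg G x) * (ln (?K G x) + 1)) \<le>
          ennreal (real (deg G x) * (ln s + 1 / s * ?K G x))"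
        by (intro ennreal_leI mult_left_mono) auto
      moreover have "ennreal (real (deg G x) * (ln (?K G x) + 1)) =
          of_nat (deg G x) * ennreal (ln (?K G x)) + of_nat (deg G x)"
        using K by (simp add: ennreal_mult distrib_left ennreal_of_nat_eq_real_of_nat)
      moreover have "ennreal (real (deg G x) * (ln s + 1 / s * ?K G x)) =
         of_nat (deg G x) * ennreal (ln s) + ennreal (1 / s) * (of_nat (deg G x) * ennreal (?K G x))"
      proof -
        have "ennreal (d * (p + t * q)) = ennreal d * ennreal p + ennreal t * (ennreal d * ennreal q)"
          if "0 \<le> d" "0 \<le> p" "0 \<le> t" "0 \<le> q" for d p t q :: real
          using that by (simp add: distrib_left ennreal_mult mult_ac)
        from this[of "real (deg G x)" "ln s" "1 / s" "?K G x"] show ?thesis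
          using K s by (simp add: ennreal_of_nat_eq_real_of_nat)
      qed
      ultimately show "of_nat (deg G x) * ennreal (ln (?K G x)) + of_nat (deg G x) \<le>
          of_nat (deg G x) * ennreal (ln s) + ennreal (1 / s) * (of_nat (deg G x) * ennreal (?K G x))"
        by simp
    qed
    also have "\<dots> = vertex_mean (\<lambda>G x. of_nat (deg G x)) * ennreal (ln s) + ennreal (1 / s) * ?B"
    proof -
      have m1: "(\<lambda>\<omega>. of_nat (deg (gr \<omega>) (rt \<omega>)) * ennreal (?K (gr \<omega>) (rt \<omega>))) \<in> borel_measurable M"
        by (rule measurable_network[OF vertex_local_comp2[OF deg vertex_local_K, of "(*)"]])
      have m2: "(\<lambda>\<omega>. of_nat (deg (gr \<omega>) (rt \<omega>)) :: ennreal) \<in> borel_measurable M"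
        by (rule measurable_network[OF deg])
      show ?thesis
        unfolding vertex_mean_def using m1 m2
        by (simp add: nn_integral_add nn_integral_cmult nn_integral_multc)
    qed
    also have "\<dots> \<le> ennreal ?D * ennreal (ln s) + ennreal (1 / s) * ennreal m"
      unfolding mean_deg(1) using deg_walk_le_moment[of k] m by (intro add_mono mult_left_mono) auto
    also have "\<dots> = ennreal (?D * ln s) + ennreal ?D"
      using D s \<open>0 < m\<close> by (simp add: ennreal_mult[symmetric] s_def)
    finally have "ennreal ?D + ?A \<le> ennreal ?D + ennreal (?D * ln s)"
      by (simp add: add.commute)
    then show ?thesis by (subst (asm) ennreal_add_left_cancel_le) simp
  qed
  finally show "ennreal (ln (catalan k)) * ennreal mean_deg + of_nat k * log_growth \<le>
    ennreal (mean_deg * ln (m / mean_deg))" by (simp add: s_def)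
qed

text \<open>In \<open>log_growth_le\<close> the growth carries a factor \<open>k\<close>, which must
  be positive to force an infinite value; hence the index starts at 2.\<close>

lemma moment_infinite:
  assumes "log_growth = \<infinity>" shows "moment (Suc (Suc k)) = \<infinity>"
proof (rule ccontr)
  assume "moment (Suc (Suc k)) \<noteq> \<infinity>"
  then obtain m where "moment (Suc (Suc k)) = ennreal m" by (cases "moment (Suc (Suc k))") auto
  from log_growth_le(1)[OF this] show False
    using assms by (simp add: ennreal_mult_top top_unique del: catalan.simps)
qed

lemma moment_ge:
  assumes "moment (Suc k) = ennreal m" "log_growth = ennreal l" "0 \<le> l"
  shows "mean_deg * catalan k * exp (l / mean_deg) ^ k \<le> m"
proof -
  have D: "0 < mean_deg" "0 < m" using mean_deg(2) log_growth_le(2)[OF assms(1)] by auto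
  have c: "1 \<le> catalan k" by (rule catalan_ge_1)
  have "ennreal (ln (catalan k) * mean_deg + real k * l) \<le> ennreal (mean_deg * ln (m / mean_deg))"
    using log_growth_le(1)[OF assms(1)] c D assms(3)
    by (simp add: assms(2) ennreal_mult ennreal_of_nat_eq_real_of_nat)
  then have "ln (catalan k) * mean_deg + real k * l \<le> mean_deg * ln (m / mean_deg)"
    using D log_growth_le(2)[OF assms(1)] by (subst (asm) ennreal_le_iff) auto
  then have "ln (catalan k) + real k * (l / mean_deg) \<le> ln (m / mean_deg)"
    using D by (simp add: field_simps)
  then have "exp (ln (catalan k) + real k * (l / mean_deg)) \<le> m / mean_deg"
    using D by (metis divide_pos_pos exp_le_cancel_iff exp_ln)
  then have "catalan k * exp (l / mean_deg) ^ k \<le> m / mean_deg"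
    using c by (simp add: exp_add exp_of_nat_mult del: times_divide_eq_right)
  then show ?thesis using D by (simp add: field_simps)
qed

lemma finite_moments:
  assumes fin: "\<And>k. moment k \<noteq> \<infinity>"
  defines "a \<equiv> \<lambda>k. enn2real (moment k)"
  shows "moment k = ennreal (a k)" "1 \<le> a k" "incseq (\<lambda>k. root (2 * k) (a k))"
proof -
  show a: "moment k = ennreal (a k)" for k
    using fin[of k] by (simp add: a_def less_top)
  show ge1: "1 \<le> a k" for k
    using moment_ge_1[of k] unfolding a by simp
  show "incseq (\<lambda>k. root (2 * k) (a k))"
  proof (rule incseq_root_log_convex)
    show "a 0 = 1" by (simp add: a_def moment_0)
    show "(a (Suc k))\<^sup>2 \<le> a k * a (Suc (Suc k))" for k
      using moment_log_convex[of k] order.trans[OF zero_le_one ge1] unfolding a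
      by (simp add: ennreal_power ennreal_mult[symmetric])
  qed (rule ge1)
qed

lemma root_moment_ge:
  assumes fin: "\<And>k. moment k \<noteq> \<infinity>" and g: "log_growth = ennreal (2 * g)" "0 \<le> g"
    and upper: "\<And>k. root (2 * k) (enn2real (moment k)) \<le> r"
  shows "2 * exp (g / mean_deg) \<le> r"
proof -
  have "2 * sqrt (exp (2 * g / mean_deg)) \<le> r"
  proof (rule growth_rate_ge)
    show "mean_deg * catalan k * exp (2 * g / mean_deg) ^ k \<le> enn2real (moment (Suc k))" for k
      using finite_moments(1)[OF fin] g by (intro moment_ge) auto
    show "root (2 * Suc k) (enn2real (moment (Suc k))) \<le> r" for k by (rule upper)
  qed (use finite_moments(2)[OF fin] mean_deg(2) in auto)
  moreover have "exp (2 * g / mean_deg) = (exp (g / mean_deg))\<^sup>2"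
    by (simp add: power2_eq_square mult_exp_exp)
  ultimately show ?thesis by simp
qed

text \<open>The value of \<open>lim\<close> is accessible only through convergence. Moments
  increase, so one infinite moment makes all later ones infinite; if all are finite, the roots
  increase to their supremum.\<close>

lemma lim_moment_ge:
  assumes g: "log_growth = 2 * g"
  shows "2 * ennreal_exp (g / ennreal mean_deg) \<le> lim (\<lambda>k. ennreal_root (2 * k) (moment k))"
proof (cases "\<exists>k. moment k = \<infinity>")
  case True
  then obtain k where k: "moment k = \<infinity>" by blast
  have "moment j = \<infinity>" if "k \<le> j" for j
    using that lift_Suc_mono_le[of moment, OF moment_mono that] k by (simp add: top_unique)
  then have "(\<lambda>k. ennreal_root (2 * k) (moment k)) \<longlonglongrightarrow> \<infinity>"
    by (intro tendsto_eventually eventually_sequentiallyI[of k]) (simp add: ennreal_root_def)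
  then show ?thesis by (simp add: limI)
next
  case False
  then have fin: "moment k \<noteq> \<infinity>" for k by blast
  let ?b = "\<lambda>k. ennreal_root (2 * k) (moment k)"
  have b: "?b k = ennreal (root (2 * k) (enn2real (moment k)))" for k
    using fin by (simp add: ennreal_root_def)
  have "incseq ?b"
    unfolding b using finite_moments(3)[OF fin] by (auto simp: incseq_def intro: ennreal_leI)
  then have lim: "lim ?b = (SUP k. ?b k)" by (intro limI LIMSEQ_SUP)
  show ?thesis
  proof (cases "(SUP k. ?b k) = \<infinity>")
    case True
    then show ?thesis unfolding lim by (simp only: infinity_ennreal_def top_greatest)
  next
    case False
    then obtain r where r: "(SUP k. ?b k) = ennreal r" "0 \<le> r" by (cases "SUP k. ?b k") auto
    have "ennreal (root (2 * k) (enn2real (moment k))) \<le> ennreal r" for k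
      unfolding r(1)[symmetric] b[symmetric] by (rule SUP_upper) simp
    then have upper: "root (2 * k) (enn2real (moment k)) \<le> r" for k
      using r by (subst (asm) ennreal_le_iff) auto
    have "log_growth \<noteq> \<infinity>" using moment_infinite[of 0] fin by blast
    then obtain g' where g': "g = ennreal g'" "0 \<le> g'"
      using g by (cases g) (auto simp: ennreal_mult_top)
    have "log_growth = ennreal (2 * g')"
      using g g' by (simp add: ennreal_mult)
    from root_moment_ge[OF fin this g'(2) upper]
    have "2 * exp (g' / mean_deg) \<le> r" .
    moreover have "ennreal_exp (g / ennreal mean_deg) = ennreal (exp (g' / mean_deg))"
      using g' mean_deg(2) by (simp add: ennreal_exp_def divide_ennreal)
    ultimately show ?thesis
      unfolding lim r(1) using ennreal_leI[of "2 * exp (g' / mean_deg)" r] by (simp add: ennreal_mult)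
  qed
qed

end

section \<open>The spectral radii\<close>

text \<open>Convexity of \<open>x * ln (x - 1)\<close> for \<open>x \<ge> 2\<close>, as a tangent
  line. The slope increases because the gain of the logarithm beats the loss of
  \<open>x / (x - 1)\<close> once \<open>x - 1 \<ge> 1\<close>; the mean value theorem does the
  rest.\<close>

lemma mult_ln_tangent:
  fixes a b :: real
  assumes "2 \<le> a" "2 \<le> b"
  shows "a * ln (a - 1) + (ln (a - 1) + a / (a - 1)) * (b - a) \<le> b * ln (b - 1)"
proof -
  let ?g = "\<lambda>x::real. x * ln (x - 1)" and ?g' = "\<lambda>x::real. ln (x - 1) + x / (x - 1)"
  have deriv: "(?g has_real_derivative ?g' x) (at x)" if "2 \<le> x" for x
    using that by (auto intro!: derivative_eq_intros simp: field_simps)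
  have mono: "?g' x \<le> ?g' y" if "2 \<le> x" "x \<le> y" for x y
  proof -
    have "ln ((x - 1) / (y - 1)) \<le> (x - 1) / (y - 1) - 1"
      using that by (intro ln_le_minus_one) simp
    then have "(y - x) / (y - 1) \<le> ln (y - 1) - ln (x - 1)"
      using that by (simp add: ln_div field_simps)
    moreover have "x / (x - 1) - y / (y - 1) = (y - x) / ((x - 1) * (y - 1))"
      using that by (simp add: field_simps)
    moreover have "(y - x) / ((x - 1) * (y - 1)) \<le> (y - x) / (1 * (y - 1))"
      using that by (intro divide_left_mono mult_right_mono) auto
    ultimately show ?thesis by simp
  qed
  consider "a = b" | "a < b" | "b < a" by linarith
  then show ?thesis
  proof cases
    case 2
    with deriv assms obtain z where z: "a < z" "z < b" "?g b - ?g a = (b - a) * ?g' z"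
      using MVT2[of a b ?g ?g'] by auto
    have "(b - a) * ?g' a \<le> (b - a) * ?g' z"
      using z assms mono[of a z] by (intro mult_left_mono) auto
    then show ?thesis using z(3) by (simp add: mult.commute)
  next
    case 3
    with deriv assms obtain z where z: "b < z" "z < a" "?g a - ?g b = (a - b) * ?g' z"
      using MVT2[of b a ?g ?g'] by auto
    have "(a - b) * ?g' z \<le> (a - b) * ?g' a"
      using z assms mono[of z a] by (intro mult_left_mono) auto
    moreover have "(a - b) * t = - (t * (b - a))" for t :: real by (simp add: algebra_simps)
    ultimately show ?thesis using z(3) by (smt (verit, best))
  qed simp
qed

text \<open>Covers every rooted graph, the single vertex included, because measurability of
  \<open>return_prob\<close> is wanted everywhere and not just almost surely. If the root has
  positive degree, connectedness gives it to all vertices.\<close>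

lemma return_prob_eq:
  assumes "valid_rooted (G, x)"
  shows "pmf (srw G x k) x = (if deg G x = 0 then 1 else walk_weight (\<lambda>d. 1 / real d) G k x x)"
proof (cases "deg G x = 0")
  case True
  then have "nbrs G x = {}" using assms by (auto simp: deg_def locally_finite_def)
  then have "srw G x k = return_pmf x"
    by (induction k) (simp_all add: bind_return_pmf srw_step_def)
  with True show ?thesis by simp
next
  case False
  have "0 < deg G v" if v: "v \<in> verts G" for v
  proof (cases "v = x")
    case False
    have "(x, v) \<in> (edges G)\<^sup>*" using assms v by (simp add: connected_graph_def)
    then obtain w where "(w, v) \<in> edges G" using False by (blast elim: rtranclE)
    then have "w \<in> nbrs G v" using assms by (auto simp: simple_graph_def nbrs_def dest: symD)
    then show ?thesis using assms v by (auto simp: deg_def locally_finite_def card_gt_0_iff)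
  qed (use \<open>deg G x \<noteq> 0\<close> in simp)
  then have "pmf (srw G x k) x = walk_weight (\<lambda>d. 1 / real d) G k x x"
    using assms by (intro pmf_srw) auto
  with False show ?thesis by simp
qed

lemma weighted_networkI:
  assumes "unimodular_network M T" "integrable M (\<lambda>\<omega>. real (root_deg (T \<omega>)))"
    and "AE \<omega> in M. no_leaves (T \<omega>)"
    and u: "AE \<omega> in M. \<forall>v\<in>verts (fst (rep_rooted_graph (T \<omega>))).
      1 \<le> u (deg (fst (rep_rooted_graph (T \<omega>))) v)"
  shows "weighted_network M T u"
proof
  show "AE \<omega> in M. weighted_graph u (fst (rep_rooted_graph (T \<omega>)))"
    using assms(3) u
  proof eventually_elim
    case (elim \<omega>)
    then show ?case
      using valid_rep_rooted[of "T \<omega>"]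
      by (cases "rep_rooted_graph (T \<omega>)") (auto simp: weighted_graph_def no_leaves.rep_eq)
  qed
qed (fact assms)+

section \<open>Jensen's inequality for the root degree, and real-valued limits\<close>

context weighted_network
begin

abbreviation "rdeg \<omega> \<equiv> real (root_deg (T \<omega>))"

lemma root_deg_measurable: "(\<lambda>\<omega>. root_deg (T \<omega>)) \<in> measurable M (count_space UNIV)"
proof -
  have "(\<lambda>\<omega>. rdeg \<omega>) \<in> borel_measurable M" using deg_integrable by auto
  then have "(\<lambda>\<omega>. nat \<lfloor>rdeg \<omega>\<rfloor>) \<in> measurable M (count_space UNIV)" by measurable
  then show ?thesis by simp
qed

lemma AE_weighted:
  assumes "\<And>G x. weighted_graph u G \<Longrightarrow> x \<in> verts G \<Longrightarrow> P G x"
  shows "AE \<omega> in M. P (gr \<omega>) (rt \<omega>)"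
  by (rule AE_mp[OF weighted]) (use rt_in assms in auto)

lemma AE_deg: "AE \<omega> in M. 2 \<le> rdeg \<omega>"
  using AE_weighted[of "\<lambda>G x. 2 \<le> deg G x", OF weighted_graph.deg2]
  by (simp add: root_deg_eq numeral_le_real_of_nat_iff)

lemma mean_deg_ln_le:
  assumes "integrable M (\<lambda>\<omega>. rdeg \<omega> * ln (sqrt (rdeg \<omega> - 1)))"
  shows "mean_deg * ln (sqrt (mean_deg - 1)) \<le> (\<integral>\<omega>. rdeg \<omega> * ln (sqrt (rdeg \<omega> - 1)) \<partial>M)"
proof -
  interpret prob_space M by (rule prob_space)
  let ?D = mean_deg
  \<comment> \<open>The slope of \<open>x * ln (x - 1)\<close> at the mean degree. The square root
    halves it, and the linear term of the tangent integrates to 0.\<close>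
  define s where "s = ln (?D - 1) + ?D / (?D - 1)"
  have D: "2 \<le> ?D" by (rule mean_deg(2))
  have "(\<integral>\<omega>. ?D * ln (sqrt (?D - 1)) + s / 2 * (rdeg \<omega> - ?D) \<partial>M) \<le>
      (\<integral>\<omega>. rdeg \<omega> * ln (sqrt (rdeg \<omega> - 1)) \<partial>M)"
  proof (rule integral_mono_AE)
    show "AE \<omega> in M. ?D * ln (sqrt (?D - 1)) + s / 2 * (rdeg \<omega> - ?D) \<le>
        rdeg \<omega> * ln (sqrt (rdeg \<omega> - 1))"
      using AE_deg
    proof eventually_elim
      case (elim \<omega>)
      show ?case
        using mult_ln_tangent[OF D elim] D elim by (simp add: s_def ln_sqrt field_simps)
    qed
  qed (use assms deg_integrable in auto)
  moreover have "(\<integral>\<omega>. ?D * ln (sqrt (?D - 1)) + s / 2 * (rdeg \<omega> - ?D) \<partial>M) =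
      ?D * ln (sqrt (?D - 1))"
    using deg_integrable by (simp add: prob_space mean_deg_def)
  ultimately show ?thesis by simp
qed

lemma lim_moment_lower:
  assumes fin: "\<And>k. moment k = ennreal (a k)" "\<And>k. 0 \<le> a k"
    and upper: "\<And>k. root (2 * k) (a k) \<le> B"
    and g: "log_growth = ennreal (2 * g)" "0 \<le> g"
  shows "2 * exp (g / mean_deg) \<le> lim (\<lambda>k. root (2 * k) (a k))"
    and "convergent (\<lambda>k. root (2 * k) (a k))"
proof -
  have a: "a k = enn2real (moment k)" for k using fin by simp
  have fin': "moment k \<noteq> \<infinity>" for k using fin by simp
  have inc: "incseq (\<lambda>k. root (2 * k) (a k))"
    using finite_moments(3)[OF fin'] by (simp add: a)
  then obtain L where L: "(\<lambda>k. root (2 * k) (a k)) \<longlonglongrightarrow> L" "\<And>k. root (2 * k) (a k) \<le> L"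
    using incseq_convergent[OF inc, of B] upper by metis
  show "convergent (\<lambda>k. root (2 * k) (a k))" using L(1) by (auto simp: convergent_def)
  have "2 * exp (g / mean_deg) \<le> L"
    using root_moment_ge[OF fin' g, of L] L(2) by (simp add: a)
  then show "2 * exp (g / mean_deg) \<le> lim (\<lambda>k. root (2 * k) (a k))"
    using L(1) by (simp add: limI)
qed

end

section \<open>Specialisation to closed walks and to simple random walk\<close>

lemma spectral_radius_bounds:
  assumes "unimodular_network M T" "integrable M (\<lambda>\<omega>. real (root_deg (T \<omega>)))"
    and "AE \<omega> in M. no_leaves (T \<omega>)"
  defines "D \<equiv> (\<integral>\<omega>. real (root_deg (T \<omega>)) \<partial>M)"
    and "I \<equiv> (\<integral>\<^sup>+ \<omega>. ennreal (real (root_deg (T \<omega>)) * ln (sqrt (real (root_deg (T \<omega>)) - 1))) \<partial>M)"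
  shows "2 * ennreal_exp (I / ennreal D) \<le> spectral_radius M T"
    and "ennreal (2 * sqrt (D - 1)) \<le> 2 * ennreal_exp (I / ennreal D)"
proof -
  interpret weighted_network M T "\<lambda>_. 1"
    using assms by (intro weighted_networkI) auto
  have meas: "(\<lambda>\<omega>. rdeg \<omega> * ln (sqrt (rdeg \<omega> - 1))) \<in> borel_measurable M"
    using root_deg_measurable by measurable
  have D: "D = mean_deg" by (simp add: D_def mean_deg_def)
  have "moment k = (\<integral>\<^sup>+ \<omega>. of_nat (num_closed_walks k' (T \<omega>)) \<partial>M)" if "k' = 2 * k" for k k'
    unfolding moment_def vertex_mean_def num_closed_walks.rep_eq case_prod_unfold that
    using card_closed_walks[OF rt_in(2,3,1)] by (simp add: ennreal_of_nat_eq_real_of_nat)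
  then have "spectral_radius M T = lim (\<lambda>k. ennreal_root (2 * k) (moment k))"
    by (simp add: spectral_radius_def)
  moreover have "log_growth = 2 * I"
  proof -
    have "2 * I = (\<integral>\<^sup>+ \<omega>. 2 * ennreal (rdeg \<omega> * ln (sqrt (rdeg \<omega> - 1))) \<partial>M)"
      unfolding I_def using meas by (intro nn_integral_cmult[symmetric]) simp
    also have "\<dots> = log_growth"
      unfolding log_growth_def vertex_mean_def
    proof (rule nn_integral_cong_AE, use AE_deg in eventually_elim)
      case (elim \<omega>)
      then show ?case
        by (simp add: root_deg_eq ln_sqrt ennreal_of_nat_eq_real_of_nat ennreal_mult[symmetric]
            flip: ennreal_numeral)
    qed
    finally show ?thesis ..
  qed
  ultimately show "2 * ennreal_exp (I / ennreal D) \<le> spectral_radius M T"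
    unfolding D using lim_moment_ge by simp
  show "ennreal (2 * sqrt (D - 1)) \<le> 2 * ennreal_exp (I / ennreal D)"
  proof (cases "I = \<infinity>")
    case True
    then show ?thesis
      by (simp add: ennreal_exp_def ennreal_top_divide ennreal_mult_top)
  next
    case False
    have nonneg: "AE \<omega> in M. 0 \<le> rdeg \<omega> * ln (sqrt (rdeg \<omega> - 1))"
      using AE_deg by eventually_elim simp
    have int: "integrable M (\<lambda>\<omega>. rdeg \<omega> * ln (sqrt (rdeg \<omega> - 1)))"
      using False meas nonneg by (intro integrableI_nonneg) (auto simp: I_def less_top)
    let ?i = "\<integral>\<omega>. rdeg \<omega> * ln (sqrt (rdeg \<omega> - 1)) \<partial>M"
    have I: "I = ennreal ?i"
      unfolding I_def by (rule nn_integral_eq_integral[OF int nonneg])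
    have i: "0 \<le> ?i" using nonneg by (rule integral_nonneg_AE)
    have D2: "2 \<le> D" unfolding D by (rule mean_deg(2))
    have "ln (sqrt (D - 1)) \<le> ?i / D"
      using mean_deg_ln_le[OF int] D2 by (simp add: D field_simps)
    then have "sqrt (D - 1) \<le> exp (?i / D)"
      using D2 exp_le_cancel_iff[of "ln (sqrt (D - 1))"] by simp
    then show ?thesis
      unfolding I using i D2
      by (simp add: divide_ennreal ennreal_exp_def ennreal_mult[symmetric] flip: ennreal_numeral)
  qed
qed

lemma srw_spectral_radius_bounds:
  assumes "unimodular_network M T" "integrable M (\<lambda>\<omega>. real (root_deg (T \<omega>)))"
    and "AE \<omega> in M. no_leaves (T \<omega>)" and bounded: "AE \<omega> in M. deg_bounded \<Delta> (T \<omega>)"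
  defines "D \<equiv> (\<integral>\<omega>. real (root_deg (T \<omega>)) \<partial>M)"
    and "J \<equiv> (\<integral>\<omega>. real (root_deg (T \<omega>)) *
               ln (sqrt (real (root_deg (T \<omega>)) - 1) / real (root_deg (T \<omega>))) \<partial>M)"
  shows "2 * exp (J / D) \<le> srw_spectral_radius M T"
    and "2 * D * sqrt (D - 1) / (\<integral>\<omega>. (real (root_deg (T \<omega>)))\<^sup>2 \<partial>M) \<le> 2 * exp (J / D)"
proof -
  \<comment> \<open>Almost surely all degrees lie between 2 and \<open>\<Delta>\<close>, which makes
    these weights at least 1.\<close>
  interpret weighted_network M T "\<lambda>d. real \<Delta> / real d"
  proof (rule weighted_networkI)
    show "AE \<omega> in M. \<forall>v\<in>verts (fst (rep_rooted_graph (T \<omega>))).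
      1 \<le> real \<Delta> / real (deg (fst (rep_rooted_graph (T \<omega>))) v)"
      using assms(3) bounded
      by eventually_elim (force simp: deg_bounded.rep_eq no_leaves.rep_eq case_prod_unfold)
  qed (fact assms)+
  interpret prob_space M by (rule prob_space)
  have D: "D = mean_deg" by (simp add: D_def mean_deg_def)
  have D2: "2 \<le> D" unfolding D by (rule mean_deg(2))
  have AE_root: "AE \<omega> in M. 2 \<le> rdeg \<omega> \<and> rdeg \<omega> \<le> real \<Delta>"
    using AE_deg bounded
  proof eventually_elim
    case (elim \<omega>)
    then show ?case using rt_in(1)[of \<omega>]
      by (simp add: deg_bounded.rep_eq case_prod_unfold root_deg_eq)
  qed
  have "AE \<omega> in M. 2 \<le> real \<Delta>" using AE_root by eventually_elim linarith
  then have \<Delta>: "2 \<le> real \<Delta>" by simp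
  have int: "integrable M (\<lambda>\<omega>. h (root_deg (T \<omega>)))" for h :: "nat \<Rightarrow> real"
  proof (rule integrable_const_bound)
    show "(\<lambda>\<omega>. h (root_deg (T \<omega>))) \<in> borel_measurable M" using root_deg_measurable by measurable
    show "AE \<omega> in M. norm (h (root_deg (T \<omega>))) \<le> (\<Sum>d\<le>\<Delta>. \<bar>h d\<bar>)"
      using AE_root by eventually_elim (auto intro!: member_le_sum[where f = "\<lambda>d. \<bar>h d\<bar>"])
  qed
  let ?p = "\<lambda>k. \<integral>\<omega>. return_prob k (T \<omega>) \<partial>M" and ?a = "\<lambda>k. real \<Delta> ^ (2 * k) * (\<integral>\<omega>. return_prob (2 * k) (T \<omega>) \<partial>M)"
  have p: "return_prob k (T \<omega>) = pmf (srw (gr \<omega>) (rt \<omega>) k) (rt \<omega>)" for k \<omega>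
    by (simp add: return_prob.rep_eq case_prod_unfold)
  have walk: "AE \<omega> in M. walk_weight (\<lambda>d. real \<Delta> / real d) (gr \<omega>) k (rt \<omega>) (rt \<omega>) =
      real \<Delta> ^ k * return_prob k (T \<omega>)" for k
    unfolding p
  proof (rule AE_weighted)
    fix G :: "nat graph" and x assume w: "weighted_graph (\<lambda>d. real \<Delta> / real d) G" and x: "x \<in> verts G"
    interpret weighted_graph "\<lambda>d. real \<Delta> / real d" G by (rule w)
    have "0 < deg G v" if "v \<in> verts G" for v using deg2[OF that] by linarith
    then show "walk_weight (\<lambda>d. real \<Delta> / real d) G k x x = real \<Delta> ^ k * pmf (srw G x k) x"
      using pmf_srw[OF simple fin _ x, of k x] walk_weight_scale[of "real \<Delta>" "\<lambda>d. 1 / real d" G k x x]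
      by simp
  qed
  have p_meas: "(\<lambda>\<omega>. return_prob k (T \<omega>)) \<in> borel_measurable M" for k
  proof -
    have "vertex_local (\<lambda>G x. if deg G x = 0 then 1 else walk_weight (\<lambda>d. 1 / real d) G k x x)"
      by (intro vertex_local_comp2[where h = "\<lambda>d t. if d = 0 then 1 else t"]
          vertex_local_deg vertex_local_walk_weight)
    from measurable_network[OF this] show ?thesis
      unfolding p
      by (subst return_prob_eq) (simp_all only: prod.collapse valid_rep_rooted simp_thms)
  qed
  have p_int: "integrable M (\<lambda>\<omega>. return_prob k (T \<omega>))" for k
    by (rule integrable_const_bound[of _ 1]) (auto simp: p pmf_le_1 p_meas[unfolded p])
  have p_le: "0 \<le> ?p k" "?p k \<le> 1" for k
    using integral_mono[OF p_int, of "\<lambda>_. 1" k] by (auto simp: p pmf_le_1 prob_space)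
  have moment: "moment k = ennreal (?a k)" for k
  proof -
    have "moment k = (\<integral>\<^sup>+ \<omega>. ennreal (real \<Delta> ^ (2 * k) * return_prob (2 * k) (T \<omega>)) \<partial>M)"
      unfolding moment_def vertex_mean_def
      by (rule nn_integral_cong_AE) (use walk[of "2 * k"] in eventually_elim, simp)
    also have "\<dots> = ennreal (\<integral>\<omega>. real \<Delta> ^ (2 * k) * return_prob (2 * k) (T \<omega>) \<partial>M)"
      using p_int by (intro nn_integral_eq_integral) (auto simp: p)
    finally show ?thesis by simp
  qed
  \<comment> \<open>The scaling survives the root as the constant \<open>\<Delta>\<close>; at
    \<open>k = 0\<close> both roots are 0.\<close>
  have root: "root (2 * k) (?a k) = real \<Delta> * root (2 * k) (?p (2 * k))" for k
    by (cases "k = 0") (auto simp: real_root_mult real_root_power_cancel)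
  define g where "g = (\<integral>\<omega>. rdeg \<omega> * (ln (rdeg \<omega> - 1) + 2 * ln (real \<Delta> / rdeg \<omega>)) \<partial>M) / 2"
  have g0: "AE \<omega> in M. 0 \<le> rdeg \<omega> * (ln (rdeg \<omega> - 1) + 2 * ln (real \<Delta> / rdeg \<omega>))"
    using AE_root by eventually_elim (auto intro!: mult_nonneg_nonneg add_nonneg_nonneg)
  have "log_growth = ennreal (2 * g)"
  proof -
    have "log_growth = (\<integral>\<^sup>+ \<omega>. ennreal (rdeg \<omega> * (ln (rdeg \<omega> - 1) + 2 * ln (real \<Delta> / rdeg \<omega>))) \<partial>M)"
      unfolding log_growth_def vertex_mean_def
    proof (rule nn_integral_cong_AE, use AE_root in eventually_elim)
      case (elim \<omega>)
      then have "0 \<le> ln (rdeg \<omega> - 1) + 2 * ln (real \<Delta> / rdeg \<omega>)"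
        by (intro add_nonneg_nonneg) auto
      then show ?case
        by (simp add: root_deg_eq ennreal_mult ennreal_of_nat_eq_real_of_nat)
    qed
    also have "\<dots> = ennreal (2 * g)"
      unfolding g_def using g0
        int[of "\<lambda>d. real d * (ln (real d - 1) + 2 * ln (real \<Delta> / real d))"]
      by (subst nn_integral_eq_integral) auto
    finally show ?thesis .
  qed
  moreover have "0 \<le> g" unfolding g_def using integral_nonneg_AE[OF g0] by simp
  moreover have "root (2 * k) (?a k) \<le> real \<Delta>" for k
  proof -
    have "root (2 * k) (?p (2 * k)) \<le> 1"
      using p_le[of "2 * k"] by (cases "k = 0") auto
    then show ?thesis unfolding root using \<Delta> mult_left_mono[of _ 1 "real \<Delta>"] by simp
  qed
  ultimately have lim: "2 * exp (g / D) \<le> lim (\<lambda>k. root (2 * k) (?a k))"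
      "convergent (\<lambda>k. root (2 * k) (?a k))"
    unfolding D using lim_moment_lower[of ?a "real \<Delta>" g] moment p_le(1) by simp_all
  obtain L where L: "(\<lambda>k. root (2 * k) (?a k)) \<longlonglongrightarrow> L" using lim(2) by (auto simp: convergent_def)
  have "(\<lambda>k. root (2 * k) (?p (2 * k))) \<longlonglongrightarrow> L / real \<Delta>"
    using tendsto_divide[OF L tendsto_const[of "real \<Delta>"]] \<Delta> unfolding root by simp
  then have srw: "srw_spectral_radius M T = L / real \<Delta>"
    unfolding srw_spectral_radius_def by (rule limI)
  \<comment> \<open>The scaling shifts the exponent \<open>g / D\<close> by
    \<open>ln \<Delta>\<close>, which cancels the factor \<open>\<Delta>\<close> of the
    roots.\<close>
  have J: "J = g - D * ln (real \<Delta>)"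
  proof -
    have "J = (\<integral>\<omega>. rdeg \<omega> * (ln (rdeg \<omega> - 1) + 2 * ln (real \<Delta> / rdeg \<omega>)) / 2 -
        ln (real \<Delta>) * rdeg \<omega> \<partial>M)"
      unfolding J_def
    proof (rule integral_cong_AE)
      show "AE \<omega> in M. rdeg \<omega> * ln (sqrt (rdeg \<omega> - 1) / rdeg \<omega>) =
          rdeg \<omega> * (ln (rdeg \<omega> - 1) + 2 * ln (real \<Delta> / rdeg \<omega>)) / 2 - ln (real \<Delta>) * rdeg \<omega>"
        using AE_root
      proof eventually_elim
        case (elim \<omega>)
        then show ?case using \<Delta> by (simp add: ln_div ln_sqrt field_simps)
      qed
    qed (use root_deg_measurable in measurable)
    also have "\<dots> = g - ln (real \<Delta>) * D"
      unfolding g_def D_def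
      using int[of "\<lambda>d. real d * (ln (real d - 1) + 2 * ln (real \<Delta> / real d))"] int[of real]
      by simp
    finally show ?thesis by simp
  qed
  then have "exp (J / D) = exp (g / D) / real \<Delta>"
    using D2 \<Delta> by (simp add: diff_divide_distrib exp_diff)
  then show "2 * exp (J / D) \<le> srw_spectral_radius M T"
    using lim(1) limI[OF L] \<Delta> by (simp add: srw divide_right_mono)
  let ?Q = "\<integral>\<omega>. (rdeg \<omega>)\<^sup>2 \<partial>M"
  have "D * 2 \<le> ?Q"
  proof -
    have "(\<integral>\<omega>. rdeg \<omega> * 2 \<partial>M) \<le> ?Q"
    proof (rule integral_mono_AE)
      show "AE \<omega> in M. rdeg \<omega> * 2 \<le> (rdeg \<omega>)\<^sup>2"
        using AE_deg by eventually_elim (simp add: power2_eq_square)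
    qed (use int[of "\<lambda>d. (real d)\<^sup>2"] deg_integrable in auto)
    then show ?thesis by (simp add: D_def)
  qed
  then have Q: "0 < ?Q" using D2 by linarith
  \<comment> \<open>The mean degree under the degree-biased law; the target is
    \<open>2 * sqrt (D - 1) / s\<close>. Jensen enters twice: by convexity for
    \<open>deg * ln (sqrt (deg - 1))\<close>, and by concavity of \<open>ln\<close> under the biased
    law for \<open>ln deg\<close>.\<close>
  define s where "s = ?Q / D"
  have s: "0 < s" using Q D2 by (simp add: s_def)
  have "D * ln (sqrt (D - 1)) - D * ln s \<le> J"
  proof -
    \<comment> \<open>The integrand is \<open>deg\<close> times the tangent to \<open>ln\<close> at
      \<open>s\<close>. Its integral is \<open>D * ln s\<close>, since \<open>- D\<close> and
      \<open>?Q / s\<close> cancel by the choice of \<open>s\<close>.\<close>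
    have "D * ln (sqrt (D - 1)) - D * ln s =
        D * ln (sqrt (D - 1)) - (\<integral>\<omega>. rdeg \<omega> * (ln s - 1) + (rdeg \<omega>)\<^sup>2 / s \<partial>M)"
      using int[of "\<lambda>d. (real d)\<^sup>2"] deg_integrable Q D2
      by (simp add: D_def[symmetric] s_def right_diff_distrib)
    also have "\<dots> \<le> (\<integral>\<omega>. rdeg \<omega> * ln (sqrt (rdeg \<omega> - 1)) \<partial>M) -
        (\<integral>\<omega>. rdeg \<omega> * (ln s - 1) + (rdeg \<omega>)\<^sup>2 / s \<partial>M)"
      unfolding D using int[of "\<lambda>d. real d * ln (sqrt (real d - 1))"]
      by (intro diff_right_mono mean_deg_ln_le)
    also have "\<dots> = (\<integral>\<omega>. rdeg \<omega> * ln (sqrt (rdeg \<omega> - 1)) - (rdeg \<omega> * (ln s - 1) + (rdeg \<omega>)\<^sup>2 / s) \<partial>M)"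
      using int[of "\<lambda>d. real d * ln (sqrt (real d - 1))"]
        int[of "\<lambda>d. real d * (ln s - 1) + (real d)\<^sup>2 / s"]
      by (rule Bochner_Integration.integral_diff[symmetric])
    also have "\<dots> \<le> J"
      unfolding J_def
    proof (rule integral_mono_AE)
      show "integrable M (\<lambda>\<omega>. rdeg \<omega> * ln (sqrt (rdeg \<omega> - 1)) - (rdeg \<omega> * (ln s - 1) + (rdeg \<omega>)\<^sup>2 / s))"
        using int[of "\<lambda>d. real d * ln (sqrt (real d - 1)) - (real d * (ln s - 1) + (real d)\<^sup>2 / s)"] .
      show "integrable M (\<lambda>\<omega>. rdeg \<omega> * ln (sqrt (rdeg \<omega> - 1) / rdeg \<omega>))"
        using int[of "\<lambda>d. real d * ln (sqrt (real d - 1) / real d)"] .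
      show "AE \<omega> in M. rdeg \<omega> * ln (sqrt (rdeg \<omega> - 1)) - (rdeg \<omega> * (ln s - 1) + (rdeg \<omega>)\<^sup>2 / s) \<le>
          rdeg \<omega> * ln (sqrt (rdeg \<omega> - 1) / rdeg \<omega>)"
        using AE_deg
      proof eventually_elim
        case (elim \<omega>)
        have "ln (rdeg \<omega>) \<le> ln s - 1 + rdeg \<omega> / s"
          using ln_le_minus_one[of "rdeg \<omega> / s"] elim s by (simp add: ln_div)
        from mult_left_mono[OF this, of "rdeg \<omega>"] show ?case
          using elim by (simp add: ln_div algebra_simps power2_eq_square)
      qed
    qed
    finally show ?thesis .
  qed
  then have "ln (sqrt (D - 1) / s) \<le> J / D"
    using D2 s by (simp add: ln_div field_simps)
  then have "sqrt (D - 1) / s \<le> exp (J / D)"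
    using D2 s exp_le_cancel_iff[of "ln (sqrt (D - 1) / s)"] by simp
  then have "2 * (sqrt (D - 1) / s) \<le> 2 * exp (J / D)" by simp
  then show "2 * D * sqrt (D - 1) / ?Q \<le> 2 * exp (J / D)"
    by (simp add: s_def mult_ac)
qed

theorem theorem1:
  fixes M :: "'a measure" and T :: "'a \<Rightarrow> rooted_graph"
  assumes "unimodular_network M T"
    and "AE \<omega> in M. is_tree (T \<omega>)"
    and "integrable M (\<lambda>\<omega>. real (root_deg (T \<omega>)))"
    and "AE \<omega> in M. no_leaves (T \<omega>)"
  shows
    "(spectral_radius M T \<ge>
        2 * ennreal_exp
          ((\<integral>\<^sup>+ \<omega>. ennreal (real (root_deg (T \<omega>)) * ln (sqrt (real (root_deg (T \<omega>)) - 1))) \<partial>M) /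
           ennreal (\<integral>\<omega>. real (root_deg (T \<omega>)) \<partial>M)) \<and>
      2 * ennreal_exp
          ((\<integral>\<^sup>+ \<omega>. ennreal (real (root_deg (T \<omega>)) * ln (sqrt (real (root_deg (T \<omega>)) - 1))) \<partial>M) /
           ennreal (\<integral>\<omega>. real (root_deg (T \<omega>)) \<partial>M)) \<ge>
        ennreal (2 * sqrt ((\<integral>\<omega>. real (root_deg (T \<omega>)) \<partial>M) - 1))) \<and>
     ((\<exists>\<Delta>. AE \<omega> in M. deg_bounded \<Delta> (T \<omega>)) \<longrightarrow>
      srw_spectral_radius M T \<ge>
        2 * exp
          ((\<integral>\<omega>. real (root_deg (T \<omega>)) *
               ln (sqrt (real (root_deg (T \<omega>)) - 1) / real (root_deg (T \<omega>))) \<partial>M) /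
           (\<integral>\<omega>. real (root_deg (T \<omega>)) \<partial>M)) \<and>
      2 * exp
          ((\<integral>\<omega>. real (root_deg (T \<omega>)) *
               ln (sqrt (real (root_deg (T \<omega>)) - 1) / real (root_deg (T \<omega>))) \<partial>M) /
           (\<integral>\<omega>. real (root_deg (T \<omega>)) \<partial>M)) \<ge>
        2 * (\<integral>\<omega>. real (root_deg (T \<omega>)) \<partial>M) * sqrt ((\<integral>\<omega>. real (root_deg (T \<omega>)) \<partial>M) - 1) /
          (\<integral>\<omega>. (real (root_deg (T \<omega>)))\<^sup>2 \<partial>M))"
proof -
  note A = spectral_radius_bounds[OF assms(1,3,4)]
  note B = srw_spectral_radius_bounds[OF assms(1,3,4)]
  show ?thesis using A B by blast
qed

end
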